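(* Let $k_1,\ldots,k_r\geq 1$ be integers ($r\ge 1$), and let $\mathcal{D}=\{z\in\mathbb{C}: \mathrm{Re}\,z<1\}$, $\Lambda=\mathbb{C}\setminus[1,+\infty)$. (i) The shifted multiple star polylogarithm $\widetilde{\mathrm{Li}}^{\star}_{k_1,\ldots,k_r}(z)=\sum_{n=0}^{+\infty}A_{k_1,\ldots,k_r}(n)z^n$ ($|z|<1$) is the generating function of a completely monotone sequence $\{A_{k_1,\ldots,k_r}(n)\}_{n\ge 0}$ with $A_{k_1,\ldots,k_r}(0)=1$. It admits a Hausdorff--Stieltjes representation on $\Lambda$. (ii) The multiple star polylogarithm $\mathrm{Li}^{\star}_{k_1,\ldots,k_r}$ extends holomorphically to $\Lambda$ and is univalent (holomorphic and injective) on $\mathcal{D}$. (iii) The shifted multiple star polylogarithm $\widetilde{\mathrm{Li}}^{\star}_{k_1,\ldots,k_r}$ extends holomorphically to $\Lambda$ and is univalent on $\mathcal{D}$. (iv) For every infinite sequence of positive integers $\mathbf{k}=(k_1,k_2,\ldots)$, the limits \[ \mathrm{Li}^{\star}_{\mathbf{k}}(z)=\lim_{r\to+\infty}\mathrm{Li}^{\star}_{k_1,\ldots,k_r}(z),\qquad \widetilde{\mathrm{Li}}^{\star}_{\mathbf{k}}(z)=\lim_{r\to+\infty}\widetilde{\mathrm{Li}}^{\star}_{k_1,\ldots,k_r}(z) \] exist locally uniformly on $\mathcal{D}$. Both limit functions are univalent on $\mathcal{D}$, and the shifted limit $\widetilde{\mathrm{Li}}^{\star}_{\mathbf{k}}$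 has a Hausdorff--Stieltjes representation on $\Lambda$.
   Context: For positive integers $k_1,\ldots,k_r$ and $|z|<1$, \[ \mathrm{Li}^{\star}_{k_1,\ldots,k_r}(z)=\sum_{n_1\geq\cdots\geq n_r\geq 1}\frac{z^{n_1}}{n_1^{k_1}\cdots n_r^{k_r}},\qquad \widetilde{\mathrm{Li}}^{\star}_{k_1,\ldots,k_r}(z)=\frac{\mathrm{Li}^{\star}_{k_1,\ldots,k_r}(z)}{z} \] (removable singularity at $0$ filled in). Thus $A_{k_1,\ldots,k_r}(n)=\frac{1}{(n+1)^{k_1}}\sum_{n+1\ge n_2\ge\cdots\ge n_r\ge 1}\frac{1}{n_2^{k_2}\cdots n_r^{k_r}}$, with the inner sum equal to $1$ when $r=1$. The same symbols denote the holomorphic extensions to $\Lambda$ whose existence is part of (ii), (iii). A sequence $\{x_n\}_{n\ge0}$ of nonnegative reals is completely monotone if $\Delta^m x_n\ge 0$ for all $m,n\ge 0$, where $\Delta x_n=x_n-x_{n+1}$. A function $h$ has a (normalized) Hausdorff--Stieltjes representation on $\Lambda$ if there is a Borel probability measure $\mu$ on $[0,1]$ such that $z\mapsto\int_{[0,1]}\frac{d\mu(t)}{1-tz}$, $z\in\Lambda$, is $h$ (i.e. is the holomorphic extension of $h$ to $\Lambda$). *)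

theory Defs
  imports "HOL-Complex_Analysis.Complex_Analysis" "HOL-Probability.Probability"
begin

definition half_plane_D :: "complex set" where
  "half_plane_D = {z. Re z < 1}"

definition slit_plane :: "complex set" where
  "slit_plane = - (complex_of_real ` {1..})"

text \<open>A summation index \<open>n\<^sub>1 \<ge> \<dots> \<ge> n\<^sub>r \<ge> 1\<close> is the list \<open>[n\<^sub>1, \<dots>, n\<^sub>r]\<close>.\<close>

definition star_indices :: "nat \<Rightarrow> nat list set" where
  "star_indices r = {ns. length ns = r \<and> sorted_wrt (\<ge>) ns \<and> (\<forall>n\<in>set ns. n \<ge> 1)}"

definition Li_star :: "nat list \<Rightarrow> complex \<Rightarrow> complex" where
  "Li_star ks z =
     (\<Sum>\<^sub>\<infinity>ns\<in>star_indices (length ks).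
        z ^ hd ns / (\<Prod>i<length ks. of_nat (ns ! i) ^ (ks ! i)))"

definition Li_star_shifted :: "nat list \<Rightarrow> complex \<Rightarrow> complex" where
  "Li_star_shifted ks z =
     (if z = 0 then Lim (at 0) (\<lambda>w. Li_star ks w / w) else Li_star ks z / z)"

text \<open>The sum runs over the tails \<open>n\<^sub>2, \<dots>, n\<^sub>r\<close>; for \<open>r = 1\<close> the only tail is the empty
  list, which contributes the empty product \<open>1\<close>.\<close>

definition A_star :: "nat list \<Rightarrow> nat \<Rightarrow> real" where
  "A_star ks n =
     1 / real (n + 1) ^ hd ks *
     (\<Sum>ns | (n + 1) # ns \<in> star_indices (length ks).
        1 / (\<Prod>i<length ns. real (ns ! i) ^ (tl ks ! i)))"

definition fwd_diff :: "(nat \<Rightarrow> real) \<Rightarrow> nat \<Rightarrow> real" where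
  "fwd_diff x n = x n - x (n + 1)"

definition completely_monotone :: "(nat \<Rightarrow> real) \<Rightarrow> bool" where
  "completely_monotone x \<longleftrightarrow> (\<forall>n. x n \<ge> 0) \<and> (\<forall>m n. (fwd_diff ^^ m) x n \<ge> 0)"

text \<open>\<open>g\<close> is a holomorphic extension to the slit plane of a function \<open>f\<close> given on \<open>S\<close>.\<close>

definition holomorphic_extension ::
    "complex set \<Rightarrow> (complex \<Rightarrow> complex) \<Rightarrow> (complex \<Rightarrow> complex) \<Rightarrow> bool" where
  "holomorphic_extension S f g \<longleftrightarrow> g holomorphic_on slit_plane \<and> (\<forall>z\<in>S. g z = f z)"

text \<open>The extensions to the slit plane of the functions given on the unit disc. They are
  uniquely determined on the slit plane if they exist (identity theorem); existence is not
  built in.\<close>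

definition Li_star_ext :: "nat list \<Rightarrow> complex \<Rightarrow> complex" where
  "Li_star_ext ks = (SOME g. holomorphic_extension (ball 0 1) (Li_star ks) g)"

definition Li_star_shifted_ext :: "nat list \<Rightarrow> complex \<Rightarrow> complex" where
  "Li_star_shifted_ext ks = (SOME g. holomorphic_extension (ball 0 1) (Li_star_shifted ks) g)"

text \<open>\<open>S\<close> is the subset of the slit plane on which \<open>h\<close> is given.\<close>

definition has_hausdorff_stieltjes :: "complex set \<Rightarrow> (complex \<Rightarrow> complex) \<Rightarrow> bool" where
  "has_hausdorff_stieltjes S h \<longleftrightarrow>
     (\<exists>\<mu> :: real measure.
        prob_space \<mu> \<and> sets \<mu> = sets (restrict_space borel {0..1}) \<and>
        holomorphic_extension S h (\<lambda>z. \<integral>t. 1 / (1 - complex_of_real t * z) \<partial>\<mu>))"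

definition univalent_on :: "(complex \<Rightarrow> complex) \<Rightarrow> complex set \<Rightarrow> bool" where
  "univalent_on f S \<longleftrightarrow> f holomorphic_on S \<and> inj_on f S"

definition locally_uniform_limit ::
    "complex set \<Rightarrow> (nat \<Rightarrow> complex \<Rightarrow> complex) \<Rightarrow> (complex \<Rightarrow> complex) \<Rightarrow> bool" where
  "locally_uniform_limit S f l \<longleftrightarrow>
     (\<forall>z\<in>S. \<exists>U. open U \<and> z \<in> U \<and> uniform_limit (U \<inter> S) f l sequentially)"

end

(*
  The coefficients A(n) are the moments of a probability measure on [0,1]: the constant sequence 1
  is one, and if a(n) = E[X^n], then a(n)/(n+1) = E[(U X)^n] and
  (a(0) + ... + a(n))/(n+1) = E[(1 - U (1 - X))^n] for U uniform on [0,1] and independent of X.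
  Hence the shifted function is F(z) = E[1/(1 - X z)], and univalence holds for every such F with
  E[X] > 0, since
    z F(z) - w F(w) = (z - w) E[1 / ((1 - X z) (1 - X w))],
    F(z) - F(w) = (z - w) E[X / ((1 - X z) (1 - X w))],
  and on Re z, Re w < 1 neither expectation vanishes. For infinite sequences the moments increase
  with r and stay below 1, so they converge, and by Helly's theorem the limits are again moments.
*)

theory Submission
  imports Defs
begin

section \<open>Moment sequences on the unit interval\<close>

text \<open>Two gaps lie between the moments and the conclusions. Moments give the power series,
  which only reaches the unit disc, whereas the half-plane is unbounded; convergence there needs a
  second expansion of the kernel whose error does not depend on the measure. And univalence of a
  locally uniform limit would classically come from Hurwitz's theorem together with nonconstancy;
  here the limit is itself a transform of a probability measure, so the argument for finite depth
  applies to it directly, and nonconstancy becomes positivity of the first moment. Monotonicity in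
  the depth is what keeps that moment from tending to 0.\<close>

locale unit_interval_prob = prob_space M for M :: "real measure" +
  assumes sets_unit: "sets M = sets (restrict_space borel {0..1})"
begin

lemma space_unit: "space M = {0..1}"
  using sets_eq_imp_space_eq[OF sets_unit] by (simp add: space_restrict_space)

lemma measurable_continuous:
  fixes f :: "real \<Rightarrow> 'a :: topological_space"
  assumes "continuous_on {0..1} f"
  shows "f \<in> borel_measurable M"
  using borel_measurable_continuous_on_restrict[OF assms]
  by (simp add: measurable_cong_sets[OF sets_unit refl])

lemma measurable_ident_unit [measurable]: "(\<lambda>t. t) \<in> borel_measurable M"
  by (intro measurable_continuous continuous_intros)

lemma integrable_continuous:
  fixes f :: "real \<Rightarrow> 'a :: {banach, second_countable_topology}"
  assumes "continuous_on {0..1} f"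
  shows "integrable M f"
proof -
  have "bounded (f ` {0..1})"
    using compact_continuous_image[OF assms compact_Icc] by (rule compact_imp_bounded)
  then obtain B where "\<forall>y\<in>f ` {0..1}. norm y \<le> B"
    by (auto simp only: bounded_iff)
  then have "\<And>t. t \<in> {0..1} \<Longrightarrow> norm (f t) \<le> B"
    by blast
  then show ?thesis
    by (intro integrable_const_bound[where B = B] AE_I2 measurable_continuous assms)
       (auto simp: space_unit)
qed

lemma norm_integral_le:
  fixes f :: "real \<Rightarrow> 'a :: {banach, second_countable_topology}"
  assumes "continuous_on {0..1} f" "\<And>t. t \<in> {0..1} \<Longrightarrow> norm (f t) \<le> B"
  shows "norm (integral\<^sup>L M f) \<le> B"
proof -
  have "norm (integral\<^sup>L M f) \<le> (\<integral>t. norm (f t) \<partial>M)"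
    by (rule integral_norm_bound)
  also have "\<dots> \<le> (\<integral>t. B \<partial>M)"
    using assms by (intro integral_mono integrable_continuous continuous_intros) (auto simp: space_unit)
  finally show ?thesis by (simp add: prob_space)
qed

end

definition moment :: "real measure \<Rightarrow> nat \<Rightarrow> real" where
  "moment M n = (\<integral>t. t ^ n \<partial>M)"

definition hausdorff_moments :: "(nat \<Rightarrow> real) \<Rightarrow> bool" where
  "hausdorff_moments a \<longleftrightarrow> (\<exists>M. unit_interval_prob M \<and> a = moment M)"

context unit_interval_prob
begin

lemma moment_0: "moment M 0 = 1"
  by (simp add: moment_def prob_space)

text \<open>Since \<open>t ^ n - t ^ (n + 1) = t ^ n * (1 - t)\<close>, each difference multiplies
  the integrand by \<open>1 - t\<close>, which is nonnegative on the unit interval. This is the easy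
  half of Hausdorff's moment theorem.\<close>

lemma fwd_diff_moment: "(fwd_diff ^^ m) (moment M) n = (\<integral>t. t ^ n * (1 - t) ^ m \<partial>M)"
proof (induction m arbitrary: n)
  case (Suc m)
  have "(\<integral>t. t ^ n * (1 - t) ^ m \<partial>M) - (\<integral>t. t ^ (n + 1) * (1 - t) ^ m \<partial>M)
      = (\<integral>t. t ^ n * (1 - t) ^ m - t ^ (n + 1) * (1 - t) ^ m \<partial>M)"
    by (intro Bochner_Integration.integral_diff[symmetric] integrable_continuous continuous_intros)
  also have "\<dots> = (\<integral>t. t ^ n * (1 - t) ^ Suc m \<partial>M)"
    by (simp add: algebra_simps)
  finally show ?case
    by (simp only: funpow.simps o_apply fwd_diff_def[of "(fwd_diff ^^ m) (moment M)"] Suc)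
qed (simp add: moment_def)

lemma completely_monotone_moment: "completely_monotone (moment M)"
proof -
  have *: "(fwd_diff ^^ m) (moment M) n \<ge> 0" for m n
    unfolding fwd_diff_moment by (intro integral_nonneg_AE AE_I2) (auto simp: space_unit)
  from *[of 0] show ?thesis
    unfolding completely_monotone_def using * by simp
qed

lemma moment_le_1: "moment M n \<le> 1"
proof -
  have "norm (moment M n) \<le> 1"
    unfolding moment_def by (intro norm_integral_le continuous_intros) (auto simp: power_le_one)
  then show ?thesis by simp
qed

end

text \<open>The witness is the law of \<open>X\<close>, pushed forward to the restricted Borel space
  on the unit interval. Every later moment sequence is produced by naming a suitable random
  variable.\<close>

lemma hausdorff_moments_random_variable:
  assumes "prob_space P" and [measurable]: "X \<in> borel_measurable P"
    and X: "\<And>x. x \<in> space P \<Longrightarrow> X x \<in> {0..1}"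
  shows "hausdorff_moments (\<lambda>n. \<integral>x. X x ^ n \<partial>P)"
proof -
  interpret P: prob_space P by fact
  let ?I = "restrict_space borel {0..1::real}"
  have meas: "X \<in> measurable P ?I"
    by (rule measurable_restrict_space2) (use X in auto)
  have "unit_interval_prob (distr P ?I X)"
    by (intro unit_interval_prob.intro unit_interval_prob_axioms.intro P.prob_space_distr meas) simp
  moreover have "(\<lambda>n. \<integral>x. X x ^ n \<partial>P) = moment (distr P ?I X)"
    unfolding moment_def
    by (intro ext integral_distr[symmetric] meas borel_measurable_continuous_on_restrict
        continuous_intros)
  ultimately show ?thesis
    unfolding hausdorff_moments_def by blast
qed

section \<open>Mixtures with a uniform variable, and closure of moment sequences\<close>

lemma unit_interval_prob_uniform: "unit_interval_prob (restrict_space lborel {0..1})"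
proof -
  have "prob_space (restrict_space lborel {0..1::real})"
    by (intro prob_spaceI) (simp add: space_restrict_space emeasure_restrict_space)
  then show ?thesis
    by (intro unit_interval_prob.intro unit_interval_prob_axioms.intro)
       (auto simp: sets_restrict_space)
qed

lemma integral_uniform_FTC:
  assumes "\<And>u. 0 \<le> u \<Longrightarrow> u \<le> 1 \<Longrightarrow> DERIV F u :> f u" "\<And>u. isCont f u"
  shows "(\<integral>u. f u \<partial>restrict_space lborel {0..1}) = F 1 - F (0 :: real)"
proof -
  have "(\<integral>u. f u \<partial>restrict_space lborel {0..1}) = (\<integral>u. f u * indicator {0..1} u \<partial>lborel)"
    by (subst integral_restrict_space) (auto simp: mult.commute)
  also have "\<dots> = F 1 - F 0"
    using assms by (intro integral_FTC_Icc_real) auto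
  finally show ?thesis .
qed

lemma integral_uniform_power:
  "(\<integral>u. u ^ n \<partial>restrict_space lborel {0..1}) = 1 / real (n + 1)"
proof -
  have "DERIV (\<lambda>u. u ^ (n + 1) / real (n + 1)) u :> u ^ n" for u :: real
    using DERIV_cdivide[OF DERIV_pow[of "n + 1" u UNIV], of "real (n + 1)"] by (simp del: of_nat_Suc)
  then have "(\<integral>u. u ^ n \<partial>restrict_space lborel {0..1}) = 1 ^ (n + 1) / real (n + 1) - 0 ^ (n + 1) / real (n + 1)"
    by (intro integral_uniform_FTC) auto
  then show ?thesis by simp
qed

text \<open>As \<open>u\<close> runs through the unit interval, \<open>1 - u * (1 - x)\<close> runs
  from 1 to \<open>x\<close>; the antiderivative gives \<open>(1 - x ^ (n + 1)) / (1 - x)\<close>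
  over \<open>n + 1\<close>, a finite geometric sum. The antiderivative divides by
  \<open>1 - x\<close>, hence the separate case \<open>x = 1\<close>.\<close>

lemma integral_uniform_affine_power:
  fixes x :: real
  shows "(\<integral>u. (1 - u * (1 - x)) ^ n \<partial>restrict_space lborel {0..1}) = (\<Sum>m\<le>n. x ^ m) / real (n + 1)"
proof (cases "x = 1")
  case True
  then show ?thesis
    using integral_uniform_power[of 0] by simp
next
  case False
  have "(\<integral>u. (1 - u * (1 - x)) ^ n \<partial>restrict_space lborel {0..1})
      = - ((1 - 1 * (1 - x)) ^ (n + 1)) / ((1 - x) * real (n + 1))
        - - ((1 - 0 * (1 - x)) ^ (n + 1)) / ((1 - x) * real (n + 1))"
  proof (rule integral_uniform_FTC)
    fix u :: real
    have "DERIV (\<lambda>u. 1 - u * (1 - x)) u :> - (1 - x)"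
      by (auto intro!: derivative_eq_intros)
    from DERIV_power[OF this, of "n + 1"]
    have "DERIV (\<lambda>u. - ((1 - u * (1 - x)) ^ (n + 1)) / ((1 - x) * real (n + 1))) u :>
        - (real (n + 1) * ((1 - u * (1 - x)) ^ n * - (1 - x))) / ((1 - x) * real (n + 1))"
      by (intro DERIV_cdivide DERIV_minus) (simp add: mult_ac)
    also have "- (real (n + 1) * ((1 - u * (1 - x)) ^ n * - (1 - x))) / ((1 - x) * real (n + 1))
        = (1 - u * (1 - x)) ^ n"
      using False by (simp add: divide_simps del: of_nat_Suc) (simp add: algebra_simps)
    finally show "DERIV (\<lambda>u. - ((1 - u * (1 - x)) ^ (n + 1)) / ((1 - x) * real (n + 1))) u :>
        (1 - u * (1 - x)) ^ n" .
  qed (auto intro!: continuous_intros)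
  also have "\<dots> = (1 - x ^ Suc n) / (1 - x) / real (n + 1)"
    by (simp add: diff_divide_distrib del: of_nat_Suc)
  also have "(1 - x ^ Suc n) / (1 - x) = (\<Sum>m\<le>n. x ^ m)"
    using False by (simp only: sum_gp0) simp
  finally show ?thesis .
qed

text \<open>By Fubini the iterated integral is the n-th moment of the law of \<open>X\<close> on the
  product of \<open>M\<close> with the uniform measure. It is applied to \<open>x * u\<close> and to
  \<open>1 - u * (1 - x)\<close>.\<close>

lemma hausdorff_moments_mixture:
  fixes X :: "real \<Rightarrow> real \<Rightarrow> real"
  assumes M: "unit_interval_prob M" and X: "continuous_on UNIV (\<lambda>p. X (fst p) (snd p))"
    and X01: "\<And>x u. x \<in> {0..1} \<Longrightarrow> u \<in> {0..1} \<Longrightarrow> X x u \<in> {0..1}"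
  shows "hausdorff_moments (\<lambda>n. \<integral>x. (\<integral>u. X x u ^ n \<partial>restrict_space lborel {0..1}) \<partial>M)"
proof -
  let ?U = "restrict_space lborel {0..1::real}"
  interpret M: unit_interval_prob M by fact
  interpret U: unit_interval_prob ?U by (rule unit_interval_prob_uniform)
  interpret pair_prob_space M ?U ..
  have space: "space (M \<Otimes>\<^sub>M ?U) = {0..1} \<times> {0..1}"
    by (simp add: space_pair_measure M.space_unit U.space_unit)
  \<comment> \<open>The coordinate pair is read as a map into the plane, whose Borel sets are the
    product of the Borel sets of the line; there continuity of \<open>X\<close> gives joint
    measurability.\<close>
  have "(\<lambda>p. (fst p, snd p)) \<in> measurable (M \<Otimes>\<^sub>M ?U) (borel \<Otimes>\<^sub>M borel)"
    by (intro measurable_Pair measurable_compose[OF measurable_fst M.measurable_ident_unit]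
        measurable_compose[OF measurable_snd U.measurable_ident_unit])
  from measurable_compose[OF this, of "\<lambda>p. X (fst p) (snd p)" borel]
  have [measurable]: "(\<lambda>p. X (fst p) (snd p)) \<in> borel_measurable (M \<Otimes>\<^sub>M ?U)"
    using borel_measurable_continuous_onI[OF X] by (simp add: borel_prod)
  have "(\<integral>p. X (fst p) (snd p) ^ n \<partial>(M \<Otimes>\<^sub>M ?U)) = (\<integral>x. (\<integral>u. X x u ^ n \<partial>?U) \<partial>M)" for n
  proof -
    have "integrable (M \<Otimes>\<^sub>M ?U) (\<lambda>p. X (fst p) (snd p) ^ n)"
    proof (intro integrable_const_bound[where B = 1] AE_I2)
      fix p assume "p \<in> space (M \<Otimes>\<^sub>M ?U)"
      with X01[of "fst p" "snd p"] show "norm (X (fst p) (snd p) ^ n) \<le> 1"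
        by (auto simp: space power_le_one norm_power)
    qed measurable
    then have "(\<integral>x. (\<integral>u. X (fst (x, u)) (snd (x, u)) ^ n \<partial>?U) \<partial>M)
        = (\<integral>p. X (fst p) (snd p) ^ n \<partial>(M \<Otimes>\<^sub>M ?U))"
      by (intro integral_fst'[of "\<lambda>p. X (fst p) (snd p) ^ n"])
    then show ?thesis by simp
  qed
  moreover have "hausdorff_moments (\<lambda>n. \<integral>p. X (fst p) (snd p) ^ n \<partial>(M \<Otimes>\<^sub>M ?U))"
  proof (rule hausdorff_moments_random_variable)
    show "prob_space (M \<Otimes>\<^sub>M ?U)" by (rule prob_space_axioms)
    show "X (fst p) (snd p) \<in> {0..1}" if "p \<in> space (M \<Otimes>\<^sub>M ?U)" for p
      using X01[of "fst p" "snd p"] that by (auto simp: space)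
  qed measurable
  ultimately show ?thesis by simp
qed

lemma hausdorff_moments_div:
  assumes "hausdorff_moments a"
  shows "hausdorff_moments (\<lambda>n. a n / real (n + 1))"
proof -
  from assms obtain M where M: "unit_interval_prob M" and a: "a = moment M"
    by (auto simp: hausdorff_moments_def)
  have "hausdorff_moments (\<lambda>n. \<integral>x. (\<integral>u. (x * u) ^ n \<partial>restrict_space lborel {0..1}) \<partial>M)"
    by (intro hausdorff_moments_mixture M continuous_intros) (auto simp: mult_le_one)
  also have "(\<lambda>n. \<integral>x. (\<integral>u. (x * u) ^ n \<partial>restrict_space lborel {0..1}) \<partial>M)
      = (\<lambda>n. a n / real (n + 1))"
    by (simp add: power_mult_distrib integral_uniform_power[simplified] a moment_def)
  finally show ?thesis .
qed

lemma hausdorff_moments_average: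
  assumes "hausdorff_moments a"
  shows "hausdorff_moments (\<lambda>n. (\<Sum>m\<le>n. a m) / real (n + 1))"
proof -
  from assms obtain M where M: "unit_interval_prob M" and a: "a = moment M"
    by (auto simp: hausdorff_moments_def)
  interpret unit_interval_prob M by fact
  have "hausdorff_moments (\<lambda>n. \<integral>x. (\<integral>u. (1 - u * (1 - x)) ^ n \<partial>restrict_space lborel {0..1}) \<partial>M)"
    by (intro hausdorff_moments_mixture M continuous_intros) (auto simp: mult_le_one)
  also have "(\<lambda>n. \<integral>x. (\<integral>u. (1 - u * (1 - x)) ^ n \<partial>restrict_space lborel {0..1}) \<partial>M)
      = (\<lambda>n. (\<Sum>m\<le>n. a m) / real (n + 1))"
    unfolding integral_uniform_affine_power a moment_def
    by (subst Bochner_Integration.integral_sum[symmetric])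
       (auto intro!: integrable_continuous continuous_intros)
  finally show ?thesis .
qed

lemma hausdorff_moments_div_power:
  "hausdorff_moments a \<Longrightarrow> hausdorff_moments (\<lambda>n. a n / real (n + 1) ^ k)"
proof (induction k)
  case (Suc k)
  then show ?case
    using hausdorff_moments_div[of "\<lambda>n. a n / real (n + 1) ^ k"] by (simp add: mult.commute)
qed simp

text \<open>The law of the constant variable 1, that is, the point mass at 1.\<close>

lemma hausdorff_moments_const_1: "hausdorff_moments (\<lambda>n. 1)"
  using hausdorff_moments_random_variable[OF unit_interval_prob.axioms(1)[OF unit_interval_prob_uniform],
      of "\<lambda>_. 1"]
  using integral_uniform_power[of 0] by simp

text \<open>Helly selection works with distributions on the whole line, so the measures are first
  transported there. Tightness is automatic from the common bounded support, and a weak limit along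
  a subsequence suffices because the full moment sequences already converge.\<close>

lemma hausdorff_moments_limit:
  assumes a: "\<And>r. hausdorff_moments (a r)" and lim: "\<And>n. (\<lambda>r. a r n) \<longlonglongrightarrow> b n"
  shows "hausdorff_moments b"
proof -
  from a have "\<forall>r. \<exists>M. unit_interval_prob M \<and> a r = moment M"
    by (simp add: hausdorff_moments_def)
  then obtain M where "\<forall>r. unit_interval_prob (M r) \<and> a r = moment (M r)"
    by (rule choice[THEN exE])
  then have M: "\<And>r. unit_interval_prob (M r)" and aM: "\<And>r. a r = moment (M r)"
    by auto
  interpret M: unit_interval_prob "M r" for r by (rule M)
  define N where "N r = distr (M r) borel (\<lambda>t. t)" for r
  interpret N: prob_space "N r" for r
    unfolding N_def by (intro M.prob_space_distr M.measurable_ident_unit)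
  have N: "real_distribution (N r)" for r
    by (intro real_distribution.intro real_distribution_axioms.intro N.prob_space_axioms)
       (auto simp: N_def)
  \<comment> \<open>Tightness is phrased with intervals open on the left; the endpoint -1 keeps a
    possible atom at 0 inside.\<close>
  have "measure (N r) {-1<..1} = 1" for r
  proof -
    have "measure (N r) {-1<..1} = measure (M r) ((\<lambda>t. t) -` {-1<..1} \<inter> space (M r))"
      unfolding N_def by (intro measure_distr M.measurable_ident_unit) auto
    also have "(\<lambda>t. t) -` {-1<..1} \<inter> space (M r) = space (M r)"
      by (auto simp: M.space_unit)
    finally show ?thesis by (simp add: M.prob_space)
  qed
  then have "tight N"
    unfolding tight_def using N by (intro conjI allI impI, simp, rule_tac x = "-1" in exI, rule_tac x = 1 in exI, simp)
  then obtain s L where s: "strict_mono (s :: nat \<Rightarrow> nat)" and L: "real_distribution L"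
    and conv: "weak_conv_m (N \<circ> id \<circ> s) L"
    using tight_imp_convergent_subsubsequence[of N id] by (auto simp: strict_mono_def)
  interpret L: real_distribution L by fact
  \<comment> \<open>Powers of \<open>t\<close> are unbounded on the line and so are no test
    functions for weak convergence. Powers of \<open>clamp\<close> are, and agree with them on the
    unit interval. The limit sequence is then realised by the law of \<open>clamp\<close> under
    \<open>L\<close>, which lives on the unit interval by construction.\<close>
  define clamp :: "real \<Rightarrow> real" where "clamp t = max 0 (min 1 t)" for t
  have clamp: "clamp t \<in> {0..1}" "isCont clamp t" "t \<in> {0..1} \<Longrightarrow> clamp t = t" for t
    unfolding clamp_def by (auto intro!: continuous_intros)
  have meas [measurable]: "clamp \<in> borel_measurable borel"
    by (rule borel_measurable_continuous_onI) (use clamp(2) in \<open>auto simp: continuous_at_imp_continuous_on\<close>)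
  have b: "b n = (\<integral>t. clamp t ^ n \<partial>L)" for n
  proof (rule LIMSEQ_unique)
    have "(\<lambda>r. \<integral>t. clamp t ^ n \<partial>((N \<circ> id \<circ> s) r)) \<longlonglongrightarrow> (\<integral>t. clamp t ^ n \<partial>L)"
    proof (rule weak_conv_imp_integral_bdd_continuous_conv[where B = 1])
      show "norm (clamp t ^ n) \<le> 1" for t
        using clamp(1)[of t] by (auto simp: norm_power power_le_one)
    qed (use N L conv in \<open>auto simp: o_def intro!: continuous_intros clamp\<close>)
    moreover have "(\<integral>t. clamp t ^ n \<partial>N r) = a r n" for r
    proof -
      have "(\<integral>t. clamp t ^ n \<partial>N r) = (\<integral>t. clamp t ^ n \<partial>M r)"
        unfolding N_def by (rule integral_distr[OF M.measurable_ident_unit]) simp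
      also have "\<dots> = (\<integral>t. t ^ n \<partial>M r)"
        by (intro Bochner_Integration.integral_cong) (auto simp: M.space_unit clamp)
      finally show ?thesis by (simp add: aM moment_def)
    qed
    ultimately show "(\<lambda>r. a (s r) n) \<longlonglongrightarrow> (\<integral>t. clamp t ^ n \<partial>L)"
      by simp
    show "(\<lambda>r. a (s r) n) \<longlonglongrightarrow> b n"
      using LIMSEQ_subseq_LIMSEQ[OF lim s] by (simp add: o_def)
  qed
  have "hausdorff_moments (\<lambda>n. \<integral>t. clamp t ^ n \<partial>L)"
    by (rule hausdorff_moments_random_variable[OF L.prob_space_axioms])
       (use clamp(1) meas in \<open>simp_all add: measurable_cong_sets[OF L.events_eq_borel refl]\<close>)
  then show ?thesis
    by (simp add: b[symmetric])
qed

section \<open>Stieltjes transforms\<close>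

lemma closed_slit: "closed (complex_of_real ` {1..})"
proof -
  have "complex_of_real ` {1..} = {z. Im z = 0 \<and> Re z \<ge> 1}"
    by (auto simp: image_iff complex_eq_iff intro!: bexI[of _ "Re _"])
  also have "closed \<dots>"
    by (intro closed_Collect_conj closed_Collect_eq closed_Collect_le continuous_intros)
  finally show ?thesis .
qed

lemma open_slit_plane: "open slit_plane"
  unfolding slit_plane_def using closed_slit by (rule open_Compl)

lemma half_plane_D_subset_slit_plane: "half_plane_D \<subseteq> slit_plane"
  by (auto simp: half_plane_D_def slit_plane_def)

lemma ball_subset_half_plane_D: "ball 0 1 \<subseteq> half_plane_D"
proof
  fix z :: complex assume "z \<in> ball 0 1"
  then show "z \<in> half_plane_D"
    using complex_Re_le_cmod[of z] by (simp add: half_plane_D_def)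
qed

lemma scaled_slit_plane_ne_1:
  assumes "z \<in> slit_plane" "t \<in> {0..1}"
  shows "complex_of_real t * z \<noteq> 1"
proof
  assume eq: "complex_of_real t * z = 1"
  then have "t \<noteq> 0" by auto
  with eq have "z = complex_of_real (1 / t)"
    by (simp add: field_simps)
  moreover have "1 / t \<ge> 1"
    using \<open>t \<noteq> 0\<close> assms(2) by simp
  ultimately show False
    using assms(1) by (simp only: slit_plane_def) blast
qed

text \<open>The slit plane is star-shaped about 0: if \<open>t * z = s\<close> with
  \<open>s >= 1\<close> and \<open>t\<close> in the unit interval, then
  \<open>(t / s) * z = 1\<close>, which was just excluded. Connectedness is needed for the identity
  theorem.\<close>

lemma connected_slit_plane: "connected slit_plane"
proof -
  have "closed_segment 0 z \<subseteq> slit_plane" if z: "z \<in> slit_plane" for z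
  proof
    fix w assume "w \<in> closed_segment 0 z"
    then obtain t where t: "0 \<le> t" "t \<le> 1" and w: "w = complex_of_real t * z"
      by (auto simp: closed_segment_def scaleR_conv_of_real)
    show "w \<in> slit_plane"
    proof (rule ccontr)
      assume "w \<notin> slit_plane"
      then obtain s where s: "s \<ge> 1" "complex_of_real t * z = of_real s"
        by (auto simp: slit_plane_def w)
      then have "complex_of_real (t / s) * z = 1"
        by (simp add: field_simps)
      moreover have "t / s \<in> {0..1}"
        using s t by simp
      ultimately show False
        using scaled_slit_plane_ne_1[OF z] by blast
    qed
  qed
  moreover have "0 \<in> slit_plane"
    by (auto simp: slit_plane_def)
  ultimately show ?thesis
    by (intro starlike_imp_connected) (auto simp: starlike_def)
qed

lemma continuous_on_slit_kernel:
  assumes "z \<in> slit_plane"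
  shows "continuous_on {0..1} (\<lambda>t. 1 / (1 - complex_of_real t * z))"
  using scaled_slit_plane_ne_1[OF assms] by (intro continuous_intros) (metis right_minus_eq)

text \<open>Compactness in \<open>t\<close> gives \<open>norm (1 - t * z) >= 1 / C\<close>. Moving
  \<open>z\<close> by less than \<open>1 / (2 * C)\<close> moves \<open>t * z\<close> by no more
  than that, so at least half of the lower bound survives for all \<open>t\<close> at once.\<close>

lemma slit_kernel_locally_bounded:
  assumes z: "z \<in> slit_plane"
  obtains d B where "d > 0" "\<And>w t. w \<in> ball z d \<Longrightarrow> t \<in> {0..1} \<Longrightarrow>
    w \<in> slit_plane \<and> norm (1 / (1 - complex_of_real t * w)) \<le> B"
proof -
  have "compact ((\<lambda>t. 1 / (1 - complex_of_real t * z)) ` {0..1})"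
    by (intro compact_continuous_image continuous_on_slit_kernel z compact_Icc)
  then have "bounded ((\<lambda>t. 1 / (1 - complex_of_real t * z)) ` {0..1})"
    by (rule compact_imp_bounded)
  then obtain C where C: "C > 0" "\<forall>y\<in>(\<lambda>t. 1 / (1 - complex_of_real t * z)) ` {0..1}. norm y \<le> C"
    by (auto simp only: bounded_pos)
  obtain e where e: "e > 0" "ball z e \<subseteq> slit_plane"
    using open_slit_plane z by (meson open_contains_ball)
  have "w \<in> slit_plane \<and> norm (1 / (1 - complex_of_real t * w)) \<le> 2 * C"
    if w: "w \<in> ball z (min e (1 / (2 * C)))" and t: "t \<in> {0..1}" for w t
  proof
    show "w \<in> slit_plane"
      using w e by auto
    have "norm (1 / (1 - complex_of_real t * z)) \<le> C"
      using C t by blast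
    then have 1: "norm (1 - complex_of_real t * z) \<ge> 1 / C"
      using scaled_slit_plane_ne_1[OF z t] C(1) by (simp add: norm_divide field_simps)
    have "norm (complex_of_real t * w - complex_of_real t * z) = t * dist z w"
      using t by (simp add: dist_norm norm_minus_commute norm_mult right_diff_distrib[symmetric])
    also have "\<dots> \<le> 1 * dist z w"
      using t by (intro mult_right_mono) auto
    also have "\<dots> \<le> 1 / (2 * C)"
      using w by auto
    finally have 2: "norm (complex_of_real t * w - complex_of_real t * z) \<le> 1 / (2 * C)" .
    have "norm (1 - complex_of_real t * z) \<le>
        norm (1 - complex_of_real t * w) + norm (complex_of_real t * w - complex_of_real t * z)"
      by (rule norm_triangle_le_diff[THEN order_trans] norm_diff_triangle_le) (rule order_refl)+
    moreover have "1 / C = 1 / (2 * C) + 1 / (2 * C)"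
      by simp
    ultimately have "norm (1 - complex_of_real t * w) \<ge> 1 / (2 * C)"
      using 1 2 by linarith
    then show "norm (1 / (1 - complex_of_real t * w)) \<le> 2 * C"
      using C(1) by (auto simp add: norm_divide divide_simps mult_ac split: if_splits)
  qed
  then show ?thesis
    using that[of "min e (1 / (2 * C))" "2 * C"] e C by auto
qed

section \<open>Difference formulas, holomorphy and power series of the transform\<close>

definition stieltjes :: "real measure \<Rightarrow> complex \<Rightarrow> complex" where
  "stieltjes M z = (\<integral>t. 1 / (1 - complex_of_real t * z) \<partial>M)"

context unit_interval_prob
begin

text \<open>The resolvent identity of the kernel, integrated. It serves injectivity and also
  holomorphy, because the integral on the right is the difference quotient.\<close>

lemma stieltjes_diff:
  assumes z: "z \<in> slit_plane" and w: "w \<in> slit_plane"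
  shows "stieltjes M z - stieltjes M w =
    (z - w) * (\<integral>t. of_real t * (1 / (1 - of_real t * z) * (1 / (1 - of_real t * w))) \<partial>M)"
proof -
  note cont = continuous_on_slit_kernel[OF z] continuous_on_slit_kernel[OF w]
  have "stieltjes M z - stieltjes M w =
      (\<integral>t. 1 / (1 - of_real t * z) - 1 / (1 - of_real t * w) \<partial>M)"
    unfolding stieltjes_def
    by (intro Bochner_Integration.integral_diff[symmetric] integrable_continuous cont)
  also have "\<dots> = (\<integral>t. (z - w) * (of_real t * (1 / (1 - of_real t * z) * (1 / (1 - of_real t * w)))) \<partial>M)"
  proof (intro Bochner_Integration.integral_cong refl)
    fix t assume "t \<in> space M"
    then have "1 - of_real t * z \<noteq> 0" "1 - of_real t * w \<noteq> 0"
      using scaled_slit_plane_ne_1[OF z, of t] scaled_slit_plane_ne_1[OF w, of t]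
      by (auto simp: space_unit)
    then show "1 / (1 - of_real t * z) - 1 / (1 - of_real t * w) =
        (z - w) * (of_real t * (1 / (1 - of_real t * z) * (1 / (1 - of_real t * w))))"
      by (simp add: divide_simps) (simp add: algebra_simps)
  qed
  also have "\<dots> = (z - w) * (\<integral>t. of_real t * (1 / (1 - of_real t * z) * (1 / (1 - of_real t * w))) \<partial>M)"
    by (rule integral_mult_right_zero)
  finally show ?thesis .
qed

lemma mult_stieltjes_diff:
  assumes z: "z \<in> slit_plane" and w: "w \<in> slit_plane"
  shows "z * stieltjes M z - w * stieltjes M w =
    (z - w) * (\<integral>t. 1 / (1 - of_real t * z) * (1 / (1 - of_real t * w)) \<partial>M)"
proof -
  note cont = continuous_on_slit_kernel[OF z] continuous_on_slit_kernel[OF w]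
  have "z * stieltjes M z - w * stieltjes M w =
      (\<integral>t. z * (1 / (1 - of_real t * z)) \<partial>M) - (\<integral>t. w * (1 / (1 - of_real t * w)) \<partial>M)"
    unfolding stieltjes_def by (simp only: integral_mult_right_zero)
  also have "\<dots> = (\<integral>t. z * (1 / (1 - of_real t * z)) - w * (1 / (1 - of_real t * w)) \<partial>M)"
    by (intro Bochner_Integration.integral_diff[symmetric] integrable_continuous
        continuous_on_mult[OF continuous_on_const] cont)
  also have "\<dots> = (\<integral>t. (z - w) * (1 / (1 - of_real t * z) * (1 / (1 - of_real t * w))) \<partial>M)"
  proof (intro Bochner_Integration.integral_cong refl)
    fix t assume "t \<in> space M"
    then have "1 - of_real t * z \<noteq> 0" "1 - of_real t * w \<noteq> 0"
      using scaled_slit_plane_ne_1[OF z, of t] scaled_slit_plane_ne_1[OF w, of t]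
      by (auto simp: space_unit)
    then show "z * (1 / (1 - of_real t * z)) - w * (1 / (1 - of_real t * w)) =
        (z - w) * (1 / (1 - of_real t * z) * (1 / (1 - of_real t * w)))"
      by (simp add: divide_simps) (simp add: algebra_simps)
  qed
  also have "\<dots> = (z - w) * (\<integral>t. 1 / (1 - of_real t * z) * (1 / (1 - of_real t * w)) \<partial>M)"
    by (rule integral_mult_right_zero)
  finally show ?thesis .
qed

text \<open>The difference quotient at \<open>z\<close> is the integral \<open>Q w\<close>, so it
  remains to see that \<open>Q\<close> is continuous at \<open>z\<close>. A second use of the
  resolvent identity extracts a factor \<open>w - z\<close> from \<open>Q w - Q z\<close>, and the
  local bound \<open>B\<close> on the kernel controls the rest by
  \<open>B * (B * B)\<close>.\<close>

lemma holomorphic_stieltjes: "stieltjes M holomorphic_on slit_plane"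
proof -
  let ?k = "\<lambda>z t. 1 / (1 - complex_of_real t * z)"
  have "\<exists>D. (stieltjes M has_field_derivative D) (at z)" if z: "z \<in> slit_plane" for z
  proof -
    obtain d B where d: "d > 0" and B: "\<And>w t. w \<in> ball z d \<Longrightarrow> t \<in> {0..1} \<Longrightarrow>
        w \<in> slit_plane \<and> norm (?k w t) \<le> B"
      using slit_kernel_locally_bounded[OF z] by blast
    define Q where "Q w = (\<integral>t. of_real t * (?k w t * ?k z t) \<partial>M)" for w
    have bound: "norm (Q w - Q z) \<le> norm (w - z) * (B * (B * B))" if w: "w \<in> ball z d" for w
    proof -
      have w': "w \<in> slit_plane" using B[OF w, of 0] by simp
      note cont = continuous_on_slit_kernel[OF z] continuous_on_slit_kernel[OF w']
      have eq: "of_real t * (?k w t * ?k z t) - of_real t * (?k z t * ?k z t)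
          = (w - z) * ((of_real t * of_real t) * (?k w t * (?k z t * ?k z t)))" if "t \<in> {0..1}" for t
        using scaled_slit_plane_ne_1[OF z that] scaled_slit_plane_ne_1[OF w' that]
        by (simp add: divide_simps) (simp add: algebra_simps)
      have "Q w - Q z = (\<integral>t. of_real t * (?k w t * ?k z t) - of_real t * (?k z t * ?k z t) \<partial>M)"
        unfolding Q_def
        by (intro Bochner_Integration.integral_diff[symmetric] integrable_continuous
            continuous_on_mult cont continuous_intros)
      also have "\<dots> = (\<integral>t. (w - z) * ((of_real t * of_real t) * (?k w t * (?k z t * ?k z t))) \<partial>M)"
        by (intro Bochner_Integration.integral_cong refl eq) (simp add: space_unit)
      also have "\<dots> = (w - z) * (\<integral>t. (of_real t * of_real t) * (?k w t * (?k z t * ?k z t)) \<partial>M)"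
        by (rule integral_mult_right_zero)
      finally have "norm (Q w - Q z) =
          norm (w - z) * norm (\<integral>t. (of_real t * of_real t) * (?k w t * (?k z t * ?k z t)) \<partial>M)"
        by (simp only: norm_mult)
      also have "norm (\<integral>t. (of_real t * of_real t) * (?k w t * (?k z t * ?k z t)) \<partial>M) \<le> B * (B * B)"
      proof (rule norm_integral_le)
        show "continuous_on {0..1} (\<lambda>t. (of_real t * of_real t) * (?k w t * (?k z t * ?k z t)))"
          by (intro continuous_on_mult cont continuous_intros)
        fix t :: real assume t: "t \<in> {0..1}"
        have k: "norm (?k w t) \<le> B" "norm (?k z t) \<le> B"
          using B[OF w t] B[OF _ t, of z] d by auto
        have "B \<ge> 0" using k(1) norm_ge_zero order_trans by blast
        have "norm (of_real t * of_real t :: complex) \<le> 1"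
          using t by (simp add: norm_mult mult_le_one)
        moreover have "norm (?k w t * (?k z t * ?k z t)) \<le> B * (B * B)"
          unfolding norm_mult using k \<open>B \<ge> 0\<close> by (intro mult_mono) auto
        ultimately have "norm (of_real t * of_real t :: complex) * norm (?k w t * (?k z t * ?k z t))
            \<le> 1 * (B * (B * B))"
          by (intro mult_mono) auto
        then show "norm ((of_real t * of_real t) * (?k w t * (?k z t * ?k z t))) \<le> B * (B * B)"
          by (simp only: norm_mult mult_1)
      qed
      finally show ?thesis
        by (simp add: mult_left_mono)
    qed
    have near: "eventually (\<lambda>w. w \<in> ball z d) (at z)"
      using d by (intro eventually_at_in_open') auto
    have "((\<lambda>w. Q w - Q z) \<longlongrightarrow> 0) (at z)"
    proof (rule Lim_null_comparison)
      show "\<forall>\<^sub>F w in at z. norm (Q w - Q z) \<le> norm (w - z) * (B * (B * B))"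
        using near by eventually_elim (rule bound)
      show "((\<lambda>w. norm (w - z) * (B * (B * B))) \<longlongrightarrow> 0) (at z)"
        by (auto intro!: tendsto_eq_intros)
    qed
    then have "(Q \<longlongrightarrow> Q z) (at z)"
      by (rule LIM_zero_cancel)
    moreover have "\<forall>\<^sub>F w in at z. Q w = (stieltjes M w - stieltjes M z) / (w - z)"
      using near eventually_neq_at_within[of z z UNIV]
    proof eventually_elim
      case (elim w)
      then have "w \<in> slit_plane" using B[of w 0] by simp
      then show ?case
        using elim(2) stieltjes_diff[OF _ z, of w] by (simp add: Q_def)
    qed
    ultimately have "((\<lambda>w. (stieltjes M w - stieltjes M z) / (w - z)) \<longlongrightarrow> Q z) (at z)"
      by (rule Lim_transform_eventually)
    then show ?thesis
      by (auto simp: has_field_derivative_iff)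
  qed
  then show ?thesis
    by (auto simp: holomorphic_on_open[OF open_slit_plane])
qed

text \<open>The kernel is a geometric series in \<open>t * z\<close>; sum and integral may be
  interchanged because \<open>norm z ^ n\<close> is a summable bound independent of
  \<open>t\<close>.\<close>

lemma stieltjes_sums:
  assumes z: "norm z < 1"
  shows "(\<lambda>n. complex_of_real (moment M n) * z ^ n) sums stieltjes M z"
proof -
  have le: "norm ((complex_of_real t * z) ^ n) \<le> norm z ^ n" if "t \<in> {0..1}" for t n
    using that by (auto simp: norm_power norm_mult intro!: power_mono mult_left_le_one_le)
  have cont: "continuous_on {0..1} (\<lambda>t. (complex_of_real t * z) ^ n)" for n
    by (intro continuous_intros)
  have "(\<lambda>n. \<integral>t. (complex_of_real t * z) ^ n \<partial>M) sums (\<integral>t. (\<Sum>n. (complex_of_real t * z) ^ n) \<partial>M)"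
  proof (rule sums_integral)
    show "integrable M (\<lambda>t. (complex_of_real t * z) ^ n)" for n
      by (intro integrable_continuous cont)
    show "AE t in M. summable (\<lambda>n. norm ((complex_of_real t * z) ^ n))"
    proof (rule AE_I2)
      fix t assume "t \<in> space M"
      then show "summable (\<lambda>n. norm ((complex_of_real t * z) ^ n))"
        using le z by (intro summable_comparison_test'[OF summable_geometric[of "norm z"]])
          (auto simp: space_unit)
    qed
    show "summable (\<lambda>n. \<integral>t. norm ((complex_of_real t * z) ^ n) \<partial>M)"
    proof (rule summable_comparison_test'[OF summable_geometric[of "norm z"]])
      show "norm (\<integral>t. norm ((complex_of_real t * z) ^ n) \<partial>M) \<le> norm z ^ n" for n
        by (intro norm_integral_le continuous_on_norm cont) (use le in auto)
    qed (use z in auto)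
  qed
  also have "(\<lambda>n. \<integral>t. (complex_of_real t * z) ^ n \<partial>M) = (\<lambda>n. complex_of_real (moment M n) * z ^ n)"
    by (simp add: power_mult_distrib moment_def flip: integral_complex_of_real)
  also have "(\<integral>t. (\<Sum>n. (complex_of_real t * z) ^ n) \<partial>M) = stieltjes M z"
    unfolding stieltjes_def
  proof (intro Bochner_Integration.integral_cong refl suminf_geometric)
    fix t assume "t \<in> space M"
    then show "norm (complex_of_real t * z) < 1"
      using le[of t 1] z by (auto simp: space_unit)
  qed
  finally show ?thesis .
qed

text \<open>Two points \<open>z\<close>, \<open>w\<close> of the half-plane: if their imaginary parts have opposite signs (or one
  vanishes), the product \<open>(1 - t z) (1 - t w)\<close> has positive real part; if the signs agree, its
  imaginary part has constant sign and vanishes only for \<open>t = 0\<close>, where the product is \<open>1\<close>.\<close>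

lemma integral_kernel_product_ne_0:
  assumes z: "Re z < 1" and w: "Re w < 1"
    and g: "continuous_on {0..1} g" "\<And>t. t \<in> {0..1} \<Longrightarrow> g t \<ge> (0 :: real)" "(\<integral>t. g t \<partial>M) \<noteq> 0"
  shows "(\<integral>t. complex_of_real (g t) * (1 / (1 - of_real t * z) * (1 / (1 - of_real t * w))) \<partial>M) \<noteq> 0"
proof
  define p where "p t = (1 - complex_of_real t * z) * (1 - complex_of_real t * w)" for t
  have pos: "1 - t * x > 0" if "t \<in> {0..1}" "x < 1" for t x :: real
  proof -
    have "t * x \<le> t * 1" using that by (intro mult_left_mono) auto
    then show ?thesis
      using that by (cases "t = 1") auto
  qed
  have zw: "z \<in> slit_plane" "w \<in> slit_plane"
    using z w half_plane_D_subset_slit_plane by (auto simp: half_plane_D_def)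
  have p0: "p t \<noteq> 0" if "t \<in> {0..1}" for t
    using scaled_slit_plane_ne_1[OF zw(1) that] scaled_slit_plane_ne_1[OF zw(2) that]
    by (auto simp: p_def)
  have cont: "continuous_on {0..1} (\<lambda>t. complex_of_real (g t) * (1 / p t))"
    using p0 g(1) by (auto simp: p_def intro!: continuous_intros)
  note int = integrable_continuous[OF cont]
  assume "(\<integral>t. complex_of_real (g t) * (1 / (1 - of_real t * z) * (1 / (1 - of_real t * w))) \<partial>M) = 0"
  then have eq0: "(\<integral>t. complex_of_real (g t) * (1 / p t) \<partial>M) = 0"
    by (simp add: p_def)
  have Re_p: "Re (p t) = (1 - t * Re z) * (1 - t * Re w) - t\<^sup>2 * (Im z * Im w)" for t
    by (simp add: p_def power2_eq_square algebra_simps)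
  have Im_p: "Im (p t) = - (t * (Im z * (1 - t * Re w) + Im w * (1 - t * Re z)))" for t
    by (simp add: p_def algebra_simps)
  show False
  proof (cases "Im z * Im w \<le> 0")
    case True
    have Re_pos: "Re (1 / p t) > 0" if "t \<in> {0..1}" for t
    proof -
      have "t\<^sup>2 * (Im z * Im w) \<le> 0"
        using mult_nonneg_nonpos[OF zero_le_power2 True] .
      moreover have "(1 - t * Re z) * (1 - t * Re w) > 0"
        using that z w by (intro mult_pos_pos pos)
      ultimately have "Re (p t) > 0"
        by (simp add: Re_p)
      then show ?thesis
        by (simp add: Re_divide p0[OF that] complex_neq_0 flip: power2_eq_square)
          (metis add_strict_increasing zero_le_power2 zero_less_power2 less_irrefl divide_pos_pos)
    qed
    have "(\<integral>t. Re (complex_of_real (g t) * (1 / p t)) \<partial>M) = 0"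
      using integral_Re[OF int] eq0 by simp
    moreover have "integrable M (\<lambda>t. Re (complex_of_real (g t) * (1 / p t)))"
      by (rule integrable_Re[OF int])
    moreover have "AE t in M. 0 \<le> Re (complex_of_real (g t) * (1 / p t))"
    proof (rule AE_I2)
      fix t assume "t \<in> space M"
      then have "0 \<le> g t * Re (1 / p t)"
        using g(2) Re_pos[of t] by (intro mult_nonneg_nonneg) (auto simp: space_unit)
      then show "0 \<le> Re (complex_of_real (g t) * (1 / p t))"
        by (simp only: scaleR_complex.sel flip: scaleR_conv_of_real)
    qed
    ultimately have "AE t in M. Re (complex_of_real (g t) * (1 / p t)) = 0"
      by (simp only: integral_nonneg_eq_0_iff_AE)
    \<comment> \<open>A nonnegative integrand with integral 0 vanishes almost everywhere, and
      \<open>Re (1 / p t)\<close> is strictly positive, so only \<open>g\<close> can vanish.\<close>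
    then have "AE t in M. g t = 0"
      using AE_space
    proof eventually_elim
      case (elim t)
      then have "g t * Re (1 / p t) = 0"
        by (simp only: scaleR_complex.sel flip: scaleR_conv_of_real)
      then show ?case using elim Re_pos[of t] by (auto simp: space_unit)
    qed
    then have "(\<integral>t. g t \<partial>M) = (\<integral>t. 0 \<partial>M)"
      using g(1) by (intro integral_cong_AE measurable_continuous) auto
    with g(3) show False by simp
  next
    case False
    then have sgn: "sgn (Im z) \<noteq> 0" "sgn (Im w) = sgn (Im z)"
      by (auto simp: sgn_if zero_less_mult_iff not_le)
    \<comment> \<open>For \<open>t > 0\<close> the sign of \<open>Im (p t)\<close> is opposite to
      that of \<open>Im z\<close>, and inversion flips it back. Multiplying by
      \<open>sgn (Im z)\<close> treats the upper and the lower half-plane together.\<close>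
    have h: "sgn (Im z) * Im (1 / p t) \<ge> 0" "Im (1 / p t) = 0 \<Longrightarrow> t = 0" if "t \<in> {0..1}" for t
    proof -
      have "sgn (Im z) * Im (1 / p t) =
          t * (\<bar>Im z\<bar> * (1 - t * Re w) + \<bar>Im w\<bar> * (1 - t * Re z)) / ((Re (p t))\<^sup>2 + (Im (p t))\<^sup>2)"
        using sgn(2) by (simp add: Im_divide Im_p abs_sgn[of "Im z"] abs_sgn[of "Im w"] algebra_simps)
      moreover have "\<bar>Im z\<bar> * (1 - t * Re w) + \<bar>Im w\<bar> * (1 - t * Re z) > 0"
        using False that z w by (intro add_pos_pos mult_pos_pos pos) auto
      moreover have "(Re (p t))\<^sup>2 + (Im (p t))\<^sup>2 > 0"
        using p0[OF that] complex_neq_0 by blast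
      ultimately show "sgn (Im z) * Im (1 / p t) \<ge> 0" "Im (1 / p t) = 0 \<Longrightarrow> t = 0"
        using that by auto
    qed
    have "(\<integral>t. sgn (Im z) * Im (complex_of_real (g t) * (1 / p t)) \<partial>M) = 0"
      using integral_Im[OF int] eq0 by simp
    moreover have "integrable M (\<lambda>t. sgn (Im z) * Im (complex_of_real (g t) * (1 / p t)))"
      by (intro integrable_mult_right integrable_Im[OF int])
    moreover have "AE t in M. 0 \<le> sgn (Im z) * Im (complex_of_real (g t) * (1 / p t))"
    proof (rule AE_I2)
      fix t assume "t \<in> space M"
      then have "0 \<le> g t * (sgn (Im z) * Im (1 / p t))"
        using mult_nonneg_nonneg[OF g(2) h(1)] by (simp only: space_unit)
      then show "0 \<le> sgn (Im z) * Im (complex_of_real (g t) * (1 / p t))"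
        by (simp only: scaleR_complex.sel mult.left_commute[of "sgn (Im z)"] flip: scaleR_conv_of_real)
    qed
    ultimately have "AE t in M. sgn (Im z) * Im (complex_of_real (g t) * (1 / p t)) = 0"
      by (simp only: integral_nonneg_eq_0_iff_AE)
    \<comment> \<open>An atom at 0 is invisible to the imaginary part, so its vanishing leaves two
      possibilities almost everywhere: \<open>g t = 0\<close> or \<open>t = 0\<close>. As
      \<open>p 0 = 1\<close>, the integrand equals \<open>g t\<close> in both, and the integral
      becomes that of \<open>g\<close>.\<close>
    then have "AE t in M. complex_of_real (g t) * (1 / p t) = complex_of_real (g t)"
      using AE_space
    proof eventually_elim
      case (elim t)
      then have "sgn (Im z) * (g t * Im (1 / p t)) = 0"
        by (simp only: scaleR_complex.sel flip: scaleR_conv_of_real)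
      then have "g t = 0 \<or> t = 0"
        using elim sgn(1) h(2)[of t] by (auto simp: space_unit)
      then show ?case by (auto simp: p_def)
    qed
    then have "(\<integral>t. complex_of_real (g t) * (1 / p t) \<partial>M) = (\<integral>t. complex_of_real (g t) \<partial>M)"
      using g(1) by (intro integral_cong_AE measurable_continuous cont continuous_intros) auto
    with eq0 g(3) show False by simp
  qed
qed

lemma univalent_mult_stieltjes: "univalent_on (\<lambda>z. z * stieltjes M z) half_plane_D"
  unfolding univalent_on_def
proof
  show "(\<lambda>z. z * stieltjes M z) holomorphic_on half_plane_D"
    by (intro holomorphic_intros holomorphic_on_subset[OF holomorphic_stieltjes]
        half_plane_D_subset_slit_plane)
  show "inj_on (\<lambda>z. z * stieltjes M z) half_plane_D"
  proof (rule inj_onI, rule ccontr)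
    fix z w assume zw: "z \<in> half_plane_D" "w \<in> half_plane_D" "z * stieltjes M z = w * stieltjes M w" "z \<noteq> w"
    then have "(\<integral>t. 1 / (1 - of_real t * z) * (1 / (1 - of_real t * w)) \<partial>M) = 0"
      using mult_stieltjes_diff[of z w] half_plane_D_subset_slit_plane by auto
    then show False
      using integral_kernel_product_ne_0[of z w "\<lambda>_. 1"] zw
      by (simp add: half_plane_D_def prob_space)
  qed
qed

text \<open>The transform of the point mass at 0 is the constant 1; a positive first moment excludes
  exactly this measure. The weight in the nonvanishing lemma is now \<open>g t = t\<close>, whose
  integral is that moment.\<close>

lemma univalent_stieltjes:
  assumes "moment M 1 > 0"
  shows "univalent_on (stieltjes M) half_plane_D"
  unfolding univalent_on_def
proof
  show "stieltjes M holomorphic_on half_plane_D"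
    by (intro holomorphic_on_subset[OF holomorphic_stieltjes] half_plane_D_subset_slit_plane)
  show "inj_on (stieltjes M) half_plane_D"
  proof (rule inj_onI, rule ccontr)
    fix z w assume zw: "z \<in> half_plane_D" "w \<in> half_plane_D" "stieltjes M z = stieltjes M w" "z \<noteq> w"
    then have "(\<integral>t. of_real t * (1 / (1 - of_real t * z) * (1 / (1 - of_real t * w))) \<partial>M) = 0"
      using stieltjes_diff[of z w] half_plane_D_subset_slit_plane by auto
    then show False
      using integral_kernel_product_ne_0[of z w "\<lambda>t. t"] zw assms
      by (simp add: half_plane_D_def moment_def)
  qed
qed

end

section \<open>Locally uniform convergence from convergence of the moments\<close>

lemma uniform_limit_mult_bounded:
  fixes f :: "'b \<Rightarrow> 'a \<Rightarrow> 'c :: real_normed_algebra"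
  assumes f: "uniform_limit U f l F" and g: "\<And>w. w \<in> U \<Longrightarrow> norm (g w) \<le> B"
  shows "uniform_limit U (\<lambda>r w. g w * f r w) (\<lambda>w. g w * l w) F"
proof (rule uniform_limitI)
  fix e :: real assume e: "e > 0"
  \<comment> \<open>On an empty set \<open>B\<close> could be negative, and it may be 0;
    \<open>C\<close> is a bound that can safely divide \<open>e\<close>.\<close>
  define C where "C = max B 1"
  have C: "C > 0" "\<And>w. w \<in> U \<Longrightarrow> norm (g w) \<le> C"
    using g by (auto simp: C_def le_max_iff_disj)
  have "\<forall>\<^sub>F r in F. \<forall>w\<in>U. dist (f r w) (l w) < e / C"
    using f e C(1) by (intro uniform_limitD) auto
  then show "\<forall>\<^sub>F r in F. \<forall>w\<in>U. dist (g w * f r w) (g w * l w) < e"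
  proof eventually_elim
    case (elim r)
    show ?case
    proof
      fix w assume w: "w \<in> U"
      have "dist (g w * f r w) (g w * l w) \<le> norm (g w) * norm (f r w - l w)"
        by (simp add: dist_norm norm_mult_ineq flip: right_diff_distrib)
      also have "\<dots> \<le> C * norm (f r w - l w)"
        using C(2)[OF w] by (rule mult_right_mono) simp
      also have "\<dots> < C * (e / C)"
        using elim w C(1) by (intro mult_strict_left_mono) (auto simp: dist_norm)
      finally show "dist (g w * f r w) (g w * l w) < e"
        using C(1) by simp
    qed
  qed
qed

text \<open>The integrals are polynomials in \<open>w\<close> whose coefficients are combinations of
  moments. The extra exponent \<open>i\<close> makes the induction close: peeling off one factor
  \<open>a + t * w * b\<close> leaves either \<open>i\<close> or \<open>Suc i\<close>, with
  multipliers \<open>a\<close> and \<open>w * b\<close> that are bounded on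
  \<open>U\<close>.\<close>

lemma uniform_limit_integral_affine_power:
  assumes N: "\<And>r. unit_interval_prob (N r)" and M: "unit_interval_prob M"
    and lim: "\<And>n. (\<lambda>r. moment (N r) n) \<longlonglongrightarrow> moment M n"
    and U: "\<And>w. w \<in> U \<Longrightarrow> norm w \<le> B"
  shows "uniform_limit U (\<lambda>r w. \<integral>t. of_real t ^ i * (a + of_real t * w * b) ^ j \<partial>N r)
           (\<lambda>w. \<integral>t. complex_of_real t ^ i * (a + of_real t * w * b) ^ j \<partial>M) sequentially"
proof (induction j arbitrary: i)
  case 0
  have "(\<lambda>r. complex_of_real (moment (N r) i)) \<longlonglongrightarrow> complex_of_real (moment M i)"
    by (intro tendsto_of_real lim)
  then show ?case
    by (auto simp: moment_def uniform_limit_iff tendsto_iff simp flip: of_real_power integral_complex_of_real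
        elim!: eventually_mono)
next
  case (Suc j)
  have split: "(\<integral>t. complex_of_real t ^ i * (a + of_real t * w * b) ^ Suc j \<partial>P)
      = a * (\<integral>t. of_real t ^ i * (a + of_real t * w * b) ^ j \<partial>P) +
        w * b * (\<integral>t. of_real t ^ Suc i * (a + of_real t * w * b) ^ j \<partial>P)"
    if "unit_interval_prob P" for P w
  proof -
    interpret unit_interval_prob P by fact
    have "(\<integral>t. complex_of_real t ^ i * (a + of_real t * w * b) ^ Suc j \<partial>P)
        = (\<integral>t. a * (of_real t ^ i * (a + of_real t * w * b) ^ j) +
              w * b * (of_real t ^ Suc i * (a + of_real t * w * b) ^ j) \<partial>P)"
      by (simp add: algebra_simps)
    also have "\<dots> = (\<integral>t. a * (of_real t ^ i * (a + of_real t * w * b) ^ j) \<partial>P) +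
        (\<integral>t. w * b * (of_real t ^ Suc i * (a + of_real t * w * b) ^ j) \<partial>P)"
      by (intro Bochner_Integration.integral_add integrable_continuous continuous_intros)
    finally show ?thesis by simp
  qed
  have "norm (w * b) \<le> B * norm b" if "w \<in> U" for w
    using U[OF that] by (simp add: norm_mult mult_right_mono)
  then show ?case
    unfolding split[OF N] split[OF M]
    by (intro uniform_limit_add uniform_limit_mult_bounded[where B = "norm a"]
        uniform_limit_mult_bounded[where B = "B * norm b"] Suc) auto
qed


text \<open>With \<open>u = 1 - t w\<close>, expanding \<open>1 / u\<close> as a geometric series in \<open>y = 1 - u / c\<close> for a large
  constant \<open>c\<close> converges uniformly as long as \<open>u\<close> stays in a bounded subset of some \<open>Re u \<ge> \<delta> > 0\<close>; its
  partial sums are polynomials in \<open>t\<close>, so their integrals are controlled by the moments.\<close>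

lemma uniform_limit_stieltjes:
  assumes N: "\<And>r. unit_interval_prob (N r)" and M: "unit_interval_prob M"
    and lim: "\<And>n. (\<lambda>r. moment (N r) n) \<longlonglongrightarrow> moment M n"
    and U: "\<And>w. w \<in> U \<Longrightarrow> norm w \<le> B" "\<And>w. w \<in> U \<Longrightarrow> Re w \<le> 1 - d" "d > 0"
  shows "uniform_limit U (\<lambda>r. stieltjes (N r)) (stieltjes M) sequentially"
proof -
  \<comment> \<open>\<open>R\<close> bounds \<open>norm (1 - t * w)\<close>. Capping \<delta> at 1
    makes \<open>1 - \<delta>\<close> nonnegative, so that
    \<open>t * (1 - \<delta>) <= 1 - \<delta>\<close>. The value of \<open>c\<close> minimises
    \<open>1 - 2 * \<delta> / c + R^2 / c^2\<close>, the bound for the squared norm of the ratio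
    \<open>y\<close>; the minimum is \<open>q^2\<close>.\<close>
  define \<delta> R where "\<delta> = min d 1" and "R = max B 0 + 1"
  define c q where "c = R\<^sup>2 / \<delta>" and "q = sqrt (1 - \<delta>\<^sup>2 / R\<^sup>2)"
  have \<delta>: "\<delta> > 0" "\<delta> \<le> 1" "\<delta> \<le> d" and R: "R \<ge> 1" "R \<ge> B + 1"
    using U(3) by (auto simp: \<delta>_def R_def)
  have c: "c > 0"
    using \<delta> R by (simp add: c_def)
  have "\<delta>\<^sup>2 / R\<^sup>2 \<le> 1"
    using \<delta> R by (simp add: power_mono)
  then have q: "0 \<le> q" "q < 1" "q\<^sup>2 = 1 - \<delta>\<^sup>2 / R\<^sup>2"
    using \<delta> R by (auto simp: q_def)
  define y where "y t w = complex_of_real (1 - 1 / c) + of_real t * w * of_real (1 / c)" for t w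
  define S where "S J P w = (\<Sum>j<J. of_real (1 / c) * (\<integral>t. y t w ^ j \<partial>P))" for J and P :: "real measure" and w

  \<comment> \<open>The remainder after \<open>J\<close> terms is \<open>y ^ J / u\<close> with
    \<open>norm u >= \<delta>\<close>. The bound is the same for all measures \<open>P\<close>, so a
    single \<open>J\<close> serves the limit and every member of the sequence.\<close>
  have approx: "norm (stieltjes P w - S J P w) \<le> q ^ J / \<delta>"
    if P: "unit_interval_prob P" and w: "w \<in> U" for P w J
  proof -
    interpret unit_interval_prob P by fact
    have "w \<in> slit_plane"
      using U(2)[OF w] U(3) half_plane_D_subset_slit_plane by (auto simp: half_plane_D_def)
    note cont = continuous_on_slit_kernel[OF this]
    have conty: "continuous_on {0..1} (\<lambda>t. of_real (1 / c) * y t w ^ j)" for j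
      unfolding y_def by (intro continuous_intros)
    have "S J P w = (\<integral>t. (\<Sum>j<J. of_real (1 / c) * y t w ^ j) \<partial>P)"
      unfolding S_def
      by (subst Bochner_Integration.integral_sum)
         (auto intro!: integrable_continuous conty simp del: of_real_divide)
    then have "stieltjes P w - S J P w =
        (\<integral>t. 1 / (1 - of_real t * w) - (\<Sum>j<J. of_real (1 / c) * y t w ^ j) \<partial>P)"
      unfolding stieltjes_def
      by (simp only:) (intro Bochner_Integration.integral_diff[symmetric] integrable_continuous cont
          continuous_on_sum conty)
    also have "norm \<dots> \<le> q ^ J / \<delta>"
    proof (rule norm_integral_le)
      show "continuous_on {0..1} (\<lambda>t. 1 / (1 - of_real t * w) - (\<Sum>j<J. of_real (1 / c) * y t w ^ j))"
        by (intro continuous_on_diff cont continuous_on_sum conty)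
      fix t :: real assume t: "t \<in> {0..1}"
      define u where "u = 1 - complex_of_real t * w"
      have yu: "y t w = 1 - u / of_real c"
        using c by (simp add: y_def u_def field_simps)
      have "t * Re w \<le> t * (1 - \<delta>)"
        using t U(2)[OF w] \<delta> by (intro mult_left_mono) auto
      also have "\<dots> \<le> 1 - \<delta>"
        using t \<delta> by (intro mult_left_le_one_le) auto
      finally have Re_u: "Re u \<ge> \<delta>"
        by (simp add: u_def)
      have "norm u \<le> 1 + t * norm w"
        unfolding u_def using t norm_triangle_ineq4[of 1 "complex_of_real t * w"] by (simp add: norm_mult)
      also have "t * norm w \<le> norm w"
        using t by (intro mult_left_le_one_le) auto
      finally have norm_u: "norm u \<le> R"
        using U(1)[OF w] R by linarith
      have u0: "u \<noteq> 0" "norm u \<ge> \<delta>"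
        using Re_u \<delta> complex_Re_le_cmod[of u] by auto
      have "(norm (y t w))\<^sup>2 = 1 - 2 * Re u / c + (norm u)\<^sup>2 / c\<^sup>2"
        unfolding yu cmod_power2 by (simp add: power2_eq_square algebra_simps add_divide_distrib)
      also have "\<dots> \<le> 1 - 2 * \<delta> / c + R\<^sup>2 / c\<^sup>2"
        using Re_u norm_u c by (intro add_mono diff_mono divide_right_mono power_mono) auto
      also have "\<dots> = q\<^sup>2"
        unfolding q(3) using \<delta> R by (simp add: c_def power2_eq_square field_simps)
      finally have norm_y: "norm (y t w) \<le> q"
        using q(1) by (rule power2_le_imp_le)
      have "y t w \<noteq> 1" "1 - y t w = u / of_real c"
        using u0(1) c by (auto simp: yu)
      then have "(\<Sum>j<J. y t w ^ j) = (1 - y t w ^ J) / (u / of_real c)"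
        by (simp add: sum_gp_strict)
      then have "(\<Sum>j<J. of_real (1 / c) * y t w ^ j) = (1 - y t w ^ J) / u"
        using c by (simp flip: sum_distrib_left sum_divide_distrib)
      then have "1 / u - (\<Sum>j<J. of_real (1 / c) * y t w ^ j) = y t w ^ J / u"
        by (simp add: diff_divide_distrib)
      also have "norm \<dots> \<le> q ^ J / \<delta>"
        unfolding norm_divide norm_power using norm_y u0 \<delta>
        using q(1) by (intro frac_le power_mono zero_le_power) auto
      finally show "norm (1 / (1 - of_real t * w) - (\<Sum>j<J. of_real (1 / c) * y t w ^ j)) \<le> q ^ J / \<delta>"
        by (simp add: u_def)
    qed
    finally show ?thesis .
  qed

  have partial: "uniform_limit U (\<lambda>r. S J (N r)) (S J M) sequentially" for J
  proof (induction J)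
    case 0
    show ?case by (simp add: S_def[abs_def] uniform_limit_const)
  next
    case (Suc J)
    have "uniform_limit U (\<lambda>r w. of_real (1 / c) * (\<integral>t. of_real t ^ 0 * (y t w) ^ J \<partial>N r))
        (\<lambda>w. of_real (1 / c) * (\<integral>t. of_real t ^ 0 * (y t w) ^ J \<partial>M)) sequentially"
      unfolding y_def
      by (rule uniform_limit_mult_bounded[OF uniform_limit_integral_affine_power[OF N M lim U(1)] order_refl])
    from uniform_limit_add[OF Suc this] show ?case
      by (simp only: S_def power_0 mult_1 sum.lessThan_Suc)
  qed

  show ?thesis
  proof (rule uniform_limitI)
    fix e :: real assume e: "e > 0"
    have "(\<lambda>J. q ^ J / \<delta>) \<longlonglongrightarrow> 0"
      using q by (intro tendsto_divide_zero LIMSEQ_realpow_zero)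
    then have "\<forall>\<^sub>F J in sequentially. q ^ J / \<delta> < e / 3"
      using e by (intro order_tendstoD) auto
    then obtain J where J: "q ^ J / \<delta> < e / 3"
      by (auto dest: eventually_happens)
    have "\<forall>\<^sub>F r in sequentially. \<forall>w\<in>U. dist (S J (N r) w) (S J M w) < e / 3"
      using partial e by (intro uniform_limitD) auto
    then show "\<forall>\<^sub>F r in sequentially. \<forall>w\<in>U. dist (stieltjes (N r) w) (stieltjes M w) < e"
    proof eventually_elim
      case (elim r)
      show ?case
      proof
        fix w assume w: "w \<in> U"
        have "dist (stieltjes (N r) w) (stieltjes M w) \<le>
            dist (stieltjes (N r) w) (S J (N r) w) + dist (S J (N r) w) (S J M w) +
            dist (stieltjes M w) (S J M w)"
          by (metis add.commute add_mono_thms_linordered_semiring(3) dist_commute dist_triangle dist_triangle_le)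
        then show "dist (stieltjes (N r) w) (stieltjes M w) < e"
          using approx[OF N[of r] w, where J = J] approx[OF M w, where J = J] bspec[OF elim w] J
          unfolding dist_norm by linarith
      qed
    qed
  qed
qed

lemma locally_uniform_limit_stieltjes:
  assumes N: "\<And>r. unit_interval_prob (N r)" and M: "unit_interval_prob M"
    and lim: "\<And>n. (\<lambda>r. moment (N r) n) \<longlonglongrightarrow> moment M n"
  shows "locally_uniform_limit half_plane_D (\<lambda>r. stieltjes (N r)) (stieltjes M)"
    and "locally_uniform_limit half_plane_D (\<lambda>r z. z * stieltjes (N r) z) (\<lambda>z. z * stieltjes M z)"
proof -
  have "\<exists>U. open U \<and> z \<in> U \<and>
      uniform_limit (U \<inter> half_plane_D) (\<lambda>r. stieltjes (N r)) (stieltjes M) sequentially \<and>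
      uniform_limit (U \<inter> half_plane_D) (\<lambda>r z. z * stieltjes (N r) z) (\<lambda>z. z * stieltjes M z) sequentially"
    if z: "z \<in> half_plane_D" for z
  proof -
    \<comment> \<open>Half the distance from \<open>z\<close> to the boundary line, so the ball of
      radius \<open>d\<close> keeps distance at least \<open>d\<close> from it.\<close>
    define d where "d = (1 - Re z) / 2"
    have d: "d > 0" using z by (simp add: d_def half_plane_D_def)
    have near: "norm w \<le> norm z + d \<and> Re w \<le> 1 - d" if "w \<in> ball z d \<inter> half_plane_D" for w
    proof
      have "norm (w - z) < d"
        using that by (simp add: dist_norm norm_minus_commute)
      then show "norm w \<le> norm z + d" "Re w \<le> 1 - d"
        using norm_triangle_sub[of w z] complex_Re_le_cmod[of "w - z"] by (auto simp: d_def field_simps)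
    qed
    have "uniform_limit (ball z d \<inter> half_plane_D) (\<lambda>r. stieltjes (N r)) (stieltjes M) sequentially"
      by (rule uniform_limit_stieltjes[OF N M lim, where B = "norm z + d" and d = d]) (use near d in auto)
    moreover from uniform_limit_mult_bounded[OF this, of "\<lambda>z. z" "norm z + d"]
    have "uniform_limit (ball z d \<inter> half_plane_D) (\<lambda>r z. z * stieltjes (N r) z)
        (\<lambda>z. z * stieltjes M z) sequentially"
      using near by blast
    ultimately show ?thesis
      using d by (intro exI[of _ "ball z d"]) auto
  qed
  then show "locally_uniform_limit half_plane_D (\<lambda>r. stieltjes (N r)) (stieltjes M)"
    and "locally_uniform_limit half_plane_D (\<lambda>r z. z * stieltjes (N r) z) (\<lambda>z. z * stieltjes M z)"
    unfolding locally_uniform_limit_def by blast+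
qed

section \<open>Multiple star polylogarithms\<close>

text \<open>The leading index is \<open>n + 1\<close> because the n-th coefficient of the shifted
  series collects the terms with \<open>z ^ (n + 1)\<close>.\<close>

definition star_tails :: "nat \<Rightarrow> nat \<Rightarrow> nat list set" where
  "star_tails r n = {ns. (n + 1) # ns \<in> star_indices r}"

lemma finite_star_tails: "finite (star_tails r n)"
proof (rule finite_subset)
  show "star_tails r n \<subseteq> {ns. set ns \<subseteq> {..n + 1} \<and> length ns = r - 1}"
    by (auto simp: star_tails_def star_indices_def)
qed (simp add: finite_lists_length_eq)

lemma star_tails_Suc_0: "star_tails (Suc 0) n = {[]}"
  by (auto simp: star_tails_def star_indices_def)

lemma star_indices_bij:
  "bij_betw (\<lambda>(n, ns). (n + 1) # ns) (SIGMA n:UNIV. star_tails (Suc r) n) (star_indices (Suc r))"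
proof (rule bij_betw_byWitness[where f' = "\<lambda>ns. (hd ns - 1, tl ns)"])
  have "hd ns - 1 + 1 = hd ns \<and> hd ns # tl ns = ns" if "ns \<in> star_indices (Suc r)" for ns
    using that by (cases ns) (auto simp: star_indices_def)
  then show "\<forall>a\<in>star_indices (Suc r). (case (hd a - 1, tl a) of (n, ns) \<Rightarrow> (n + 1) # ns) = a"
    and "(\<lambda>ns. (hd ns - 1, tl ns)) ` star_indices (Suc r) \<subseteq> (SIGMA n:UNIV. star_tails (Suc r) n)"
    by (auto simp: star_tails_def)
qed (auto simp: star_tails_def)

lemma star_tails_bij:
  "bij_betw (\<lambda>(m, ns). (m + 1) # ns) (SIGMA m:{..n}. star_tails (Suc r) m) (star_tails (Suc (Suc r)) n)"
proof (rule bij_betw_byWitness[where f' = "\<lambda>ns. (hd ns - 1, tl ns)"])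
  have "hd ns - 1 + 1 = hd ns \<and> hd ns # tl ns = ns \<and> hd ns - 1 \<le> n \<and> tl ns \<in> star_tails (Suc r) (hd ns - 1)"
    if "ns \<in> star_tails (Suc (Suc r)) n" for ns
    using that by (cases ns) (auto simp: star_tails_def star_indices_def)
  then show "\<forall>a\<in>star_tails (Suc (Suc r)) n. (case (hd a - 1, tl a) of (n, ns) \<Rightarrow> (n + 1) # ns) = a"
    and "(\<lambda>ns. (hd ns - 1, tl ns)) ` star_tails (Suc (Suc r)) n \<subseteq> (SIGMA m:{..n}. star_tails (Suc r) m)"
    by (simp_all add: image_subset_iff)
  show "(\<lambda>(m, ns). (m + 1) # ns) ` (SIGMA m:{..n}. star_tails (Suc r) m) \<subseteq> star_tails (Suc (Suc r)) n"
    by (fastforce simp: star_tails_def star_indices_def)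
qed auto

lemma prod_Cons_power:
  "(\<Prod>i<Suc r. real ((n # ns) ! i) ^ ((k # ks) ! i)) = real n ^ k * (\<Prod>i<r. real (ns ! i) ^ (ks ! i))"
  by (simp only: prod.lessThan_Suc_shift nth_Cons_0 nth_Cons_Suc)

lemma A_star_Cons_eq_sum:
  "A_star (k # ks) n = (\<Sum>ns\<in>star_tails (Suc (length ks)) n.
     1 / (\<Prod>i<Suc (length ks). real (((n + 1) # ns) ! i) ^ ((k # ks) ! i)))"
  unfolding A_star_def sum_distrib_left prod_Cons_power
  by (intro sum.cong) (auto simp: star_tails_def star_indices_def simp del: of_nat_Suc)

lemma A_star_singleton: "A_star [k] n = 1 / real (n + 1) ^ k"
  by (simp add: A_star_Cons_eq_sum star_tails_Suc_0)

text \<open>Sorting the tails by their first entry \<open>m + 1 <= n + 1\<close> leaves a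
  coefficient with one index fewer. This recursion is what links nested sums to averages and
  divisions by \<open>n + 1\<close>.\<close>

lemma A_star_Cons_Cons: "A_star (j # k # ks) n = (\<Sum>m\<le>n. A_star (k # ks) m) / real (n + 1) ^ j"
proof -
  let ?p = "\<lambda>ns. 1 / (\<Prod>i<Suc (length ks). real (ns ! i) ^ ((k # ks) ! i))"
  have "A_star (j # k # ks) n = 1 / real (n + 1) ^ j * (\<Sum>ns\<in>star_tails (Suc (Suc (length ks))) n. ?p ns)"
    unfolding A_star_Cons_eq_sum list.size(4) add_0_right add_Suc_right
      prod_Cons_power[where r = "Suc (length ks)"] sum_distrib_left
    by (simp only: times_divide_times_eq mult_1)
  also have "(\<Sum>ns\<in>star_tails (Suc (Suc (length ks))) n. ?p ns) =
      (\<Sum>(m, ns)\<in>(SIGMA m:{..n}. star_tails (Suc (length ks)) m). ?p ((m + 1) # ns))"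
    by (subst sum.reindex_bij_betw[OF star_tails_bij, symmetric]) (simp add: case_prod_unfold)
  also have "\<dots> = (\<Sum>m\<le>n. A_star (k # ks) m)"
    unfolding A_star_Cons_eq_sum by (subst sum.Sigma) (auto simp: finite_star_tails)
  finally show ?thesis by simp
qed

lemma hausdorff_moments_A_star:
  assumes "ks \<noteq> []" "\<forall>k\<in>set ks. k \<ge> 1"
  shows "hausdorff_moments (A_star ks)"
  using assms
proof (induction ks rule: list_nonempty_induct)
  case (single k)
  show ?case
    using hausdorff_moments_div_power[OF hausdorff_moments_const_1, of k]
    by (simp add: A_star_singleton[abs_def])
next
  case (cons j ks)
  obtain k ks' where ks: "ks = k # ks'"
    using cons.hyps by (cases ks) auto
  \<comment> \<open>As \<open>j >= 1\<close>, one factor \<open>1 / (n + 1)\<close> is available to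
    turn the sum into an average; the other \<open>j - 1\<close> are plain divisions.\<close>
  have "hausdorff_moments (\<lambda>n. (\<Sum>m\<le>n. A_star ks m) / real (n + 1) / real (n + 1) ^ (j - 1))"
    using cons by (intro hausdorff_moments_div_power hausdorff_moments_average) auto
  also have "(\<lambda>n. (\<Sum>m\<le>n. A_star ks m) / real (n + 1) / real (n + 1) ^ (j - 1)) = A_star (j # ks)"
  proof
    fix n
    have "real (n + 1) ^ j = real (n + 1) * real (n + 1) ^ (j - 1)"
      using cons.prems by (cases j) auto
    then show "(\<Sum>m\<le>n. A_star ks m) / real (n + 1) / real (n + 1) ^ (j - 1) = A_star (j # ks) n"
      unfolding ks A_star_Cons_Cons by (simp only: divide_divide_eq_left)
  qed
  finally show ?case .
qed

lemma A_star_nonneg: "A_star ks n \<ge> 0"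
  unfolding A_star_def by (intro mult_nonneg_nonneg sum_nonneg divide_nonneg_nonneg prod_nonneg) auto

text \<open>Appending an index replaces the innermost empty product 1 by a sum of nonnegative terms
  whose first term, at \<open>m = 0\<close>, is already 1. The recursion carries the inequality
  outwards.\<close>

lemma A_star_le_append:
  assumes "ks \<noteq> []"
  shows "A_star ks n \<le> A_star (ks @ [k]) n"
  using assms
proof (induction ks arbitrary: n rule: list_nonempty_induct)
  case (single j)
  have "1 = (\<Sum>m\<in>{0::nat}. 1 / real (m + 1) ^ k)"
    by simp
  also have "\<dots> \<le> (\<Sum>m\<le>n. 1 / real (m + 1) ^ k)"
    by (intro sum_mono2) auto
  finally show ?case
    unfolding append_Cons append_Nil A_star_Cons_Cons A_star_singleton by (intro divide_right_mono) auto
next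
  case (cons j ks)
  obtain i ks' where ks: "ks = i # ks'"
    using cons.hyps by (cases ks) auto
  show ?case
    using cons.IH unfolding ks append_Cons A_star_Cons_Cons
    by (intro divide_right_mono sum_mono) auto
qed

text \<open>The unordered sum over index lists is regrouped by leading index. This is legitimate
  because the norms in group \<open>n\<close> add up to
  \<open>A_star ks n * norm z ^ (n + 1)\<close>, dominated by a geometric series. The upper bound 1
  on the coefficients is supplied later by the moments.\<close>

lemma Li_star_sums:
  assumes ks: "ks \<noteq> []" and bound: "\<And>n. A_star ks n \<le> 1" and z: "norm z < 1"
  shows "(\<lambda>n. complex_of_real (A_star ks n) * z ^ (n + 1)) sums Li_star ks z"
proof -
  obtain k ks' where ks_eq: "ks = k # ks'"
    using ks by (cases ks) auto
  then have len: "length ks = Suc (length ks')" by simp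
  let ?T = "\<lambda>n. star_tails (length ks) n"
  define f where "f = (\<lambda>(n, ns). z ^ (n + 1) / (\<Prod>i<length ks. of_nat (((n + 1) # ns) ! i) ^ (ks ! i)))"
  have norm_f: "norm (f (n, ns)) = norm z ^ (n + 1) * (1 / (\<Prod>i<length ks. real (((n + 1) # ns) ! i) ^ (ks ! i)))"
    for n ns
    by (simp add: f_def norm_divide norm_power norm_mult flip: prod_norm)
  have A: "A_star ks n = (\<Sum>ns\<in>?T n. 1 / (\<Prod>i<length ks. real (((n + 1) # ns) ! i) ^ (ks ! i)))" for n
    unfolding ks_eq A_star_Cons_eq_sum by simp
  have sum_f: "(\<Sum>ns\<in>?T n. f (n, ns)) = complex_of_real (A_star ks n) * z ^ (n + 1)" for n
    unfolding A by (simp add: f_def sum_distrib_left sum_distrib_right)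
  have sum_norm_f: "(\<Sum>ns\<in>?T n. norm (f (n, ns))) = A_star ks n * norm z ^ (n + 1)" for n
    unfolding A norm_f by (simp add: sum_distrib_left sum_distrib_right)
  have summ: "summable (\<lambda>n. norm (A_star ks n * norm z ^ (n + 1)))"
  proof (rule summable_comparison_test')
    show "summable (\<lambda>n. norm z ^ (n + 1))"
      using z by (simp add: summable_mult summable_geometric)
    show "norm (norm (A_star ks n * norm z ^ (n + 1))) \<le> norm z ^ (n + 1)" for n
      using bound[of n] A_star_nonneg[of ks n] by (simp add: abs_mult mult_left_le_one_le)
  qed
  have "(\<lambda>p. norm (f p)) summable_on (SIGMA n:UNIV. ?T n)"
    unfolding Infinite_Sum.abs_summable_on_Sigma_iff
  proof
    show "\<forall>n\<in>UNIV. (\<lambda>ns. norm (f (n, ns))) summable_on ?T n"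
      by (simp add: finite_star_tails)
    have eq: "(\<Sum>\<^sub>\<infinity>ns\<in>?T n. norm (f (n, ns))) = A_star ks n * norm z ^ (n + 1)" for n
      by (simp add: finite_star_tails sum_norm_f)
    show "(\<lambda>n. norm (\<Sum>\<^sub>\<infinity>ns\<in>?T n. norm (f (n, ns)))) summable_on UNIV"
      unfolding eq using summ by (intro norm_summable_imp_summable_on) simp
  qed
  then have "f summable_on (SIGMA n:UNIV. ?T n)"
    by (rule abs_summable_summable)
  then have total: "(f has_sum infsum f (SIGMA n:UNIV. ?T n)) (SIGMA n:UNIV. ?T n)"
    by (rule has_sum_infsum)
  have "infsum f (SIGMA n:UNIV. ?T n) = Li_star ks z"
  proof -
    have "infsum f (SIGMA n:UNIV. ?T n) = (\<Sum>\<^sub>\<infinity>p\<in>(SIGMA n:UNIV. ?T n).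
        (\<lambda>ns. z ^ hd ns / (\<Prod>i<length ks. of_nat (ns ! i) ^ (ks ! i))) ((\<lambda>(n, ns). (n + 1) # ns) p))"
      by (intro infsum_cong) (auto simp: f_def)
    also have "\<dots> = Li_star ks z"
      unfolding Li_star_def len by (rule infsum_reindex_bij_betw[OF star_indices_bij])
    finally show ?thesis .
  qed
  with total have "(f has_sum Li_star ks z) (SIGMA n:UNIV. ?T n)"
    by simp
  then have "((\<lambda>n. \<Sum>ns\<in>?T n. f (n, ns)) has_sum Li_star ks z) UNIV"
    by (rule has_sum_SigmaD) (simp add: finite_star_tails)
  then show ?thesis
    unfolding sum_f by (rule has_sum_imp_sums)
qed

section \<open>Identification with Stieltjes transforms on the slit plane\<close>

text \<open>The extensions are fixed only by a choice operator; uniqueness identifies the chosen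
  function with any explicit extension.\<close>

lemma holomorphic_extension_unique:
  assumes "holomorphic_extension (ball 0 1) f g" "holomorphic_extension (ball 0 1) f h" "z \<in> slit_plane"
  shows "g z = h z"
proof (rule analytic_continuation_open[of "ball 0 1" slit_plane g h])
  show "ball 0 1 \<subseteq> slit_plane"
    using ball_subset_half_plane_D half_plane_D_subset_slit_plane by blast
qed (use assms open_slit_plane connected_slit_plane in \<open>auto simp: holomorphic_extension_def\<close>)

context unit_interval_prob
begin

lemma has_hausdorff_stieltjes_stieltjes:
  assumes "\<And>z. z \<in> S \<Longrightarrow> h z = stieltjes M z"
  shows "has_hausdorff_stieltjes S h"
  unfolding has_hausdorff_stieltjes_def holomorphic_extension_def
  using assms prob_space_axioms sets_unit holomorphic_stieltjes
  by (intro exI[of _ M]) (auto simp: stieltjes_def[abs_def])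

lemma Li_star_eq_stieltjes:
  assumes ks: "ks \<noteq> []" and A: "A_star ks = moment M" and z: "norm z < 1"
  shows "Li_star ks z = z * stieltjes M z"
proof -
  have "(\<lambda>n. z * (complex_of_real (A_star ks n) * z ^ n)) sums (z * stieltjes M z)"
    unfolding A by (intro sums_mult stieltjes_sums z)
  moreover have "(\<lambda>n. complex_of_real (A_star ks n) * z ^ (n + 1)) sums Li_star ks z"
    using moment_le_1 by (intro Li_star_sums ks z) (simp add: A)
  ultimately show ?thesis
    by (simp add: sums_unique2 mult_ac)
qed

lemma Li_star_shifted_eq_stieltjes:
  assumes ks: "ks \<noteq> []" and A: "A_star ks = moment M" and z: "norm z < 1"
  shows "Li_star_shifted ks z = stieltjes M z"
proof (cases "z = 0")
  \<comment> \<open>The value at 0 is defined as a limit of \<open>Li_star ks w / w\<close>. Near 0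
    that quotient is the transform, so continuity of the transform supplies the limit.\<close>
  case True
  have "0 \<in> slit_plane"
    by (auto simp: slit_plane_def)
  then have "stieltjes M \<midarrow>0\<rightarrow> stieltjes M 0"
    using holomorphic_on_imp_continuous_on[OF holomorphic_stieltjes] open_slit_plane
    by (auto simp: continuous_on_eq_continuous_at isCont_def)
  moreover have "\<forall>\<^sub>F w in at 0. w \<in> ball 0 1 \<and> w \<noteq> (0 :: complex)"
    by (intro eventually_conj eventually_at_in_open' eventually_neq_at_within) auto
  then have "\<forall>\<^sub>F w in at 0. stieltjes M w = Li_star ks w / w"
    by eventually_elim (simp add: Li_star_eq_stieltjes[OF ks A])
  ultimately have "((\<lambda>w. Li_star ks w / w) \<longlongrightarrow> stieltjes M 0) (at 0)"
    by (rule Lim_transform_eventually)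
  then show ?thesis
    using True by (simp add: Li_star_shifted_def tendsto_Lim)
next
  case False
  then show ?thesis
    by (simp add: Li_star_shifted_def Li_star_eq_stieltjes[OF ks A z])
qed

lemma holomorphic_extension_Li_star:
  assumes ks: "ks \<noteq> []" and A: "A_star ks = moment M"
  shows "holomorphic_extension (ball 0 1) (Li_star ks) (\<lambda>z. z * stieltjes M z)"
    and "holomorphic_extension (ball 0 1) (Li_star_shifted ks) (stieltjes M)"
  using Li_star_eq_stieltjes[OF ks A] Li_star_shifted_eq_stieltjes[OF ks A] holomorphic_stieltjes
  by (auto simp: holomorphic_extension_def intro!: holomorphic_intros)

lemma holomorphic_extension_Li_star_ext:
  assumes "ks \<noteq> []" "A_star ks = moment M"
  shows "holomorphic_extension (ball 0 1) (Li_star ks) (Li_star_ext ks)"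
    and "holomorphic_extension (ball 0 1) (Li_star_shifted ks) (Li_star_shifted_ext ks)"
  unfolding Li_star_ext_def Li_star_shifted_ext_def
  using someI[of "holomorphic_extension (ball 0 1) (Li_star ks)",
      OF holomorphic_extension_Li_star(1)[OF assms]]
    someI[of "holomorphic_extension (ball 0 1) (Li_star_shifted ks)",
      OF holomorphic_extension_Li_star(2)[OF assms]]
  by blast+

lemma Li_star_ext_eq:
  assumes "ks \<noteq> []" "A_star ks = moment M" "z \<in> slit_plane"
  shows "Li_star_ext ks z = z * stieltjes M z" and "Li_star_shifted_ext ks z = stieltjes M z"
  using holomorphic_extension_unique holomorphic_extension_Li_star[OF assms(1,2)]
    holomorphic_extension_Li_star_ext[OF assms(1,2)] assms(3) by blast+

end

lemma univalent_on_cong: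
  assumes "univalent_on f S" "\<And>z. z \<in> S \<Longrightarrow> f z = g z"
  shows "univalent_on g S"
  using assms by (auto simp: univalent_on_def cong: holomorphic_cong inj_on_cong)

text \<open>The sequence in the theorem starts at depth 0 with the empty index list, where the
  moment lemmas do not apply; the limit ignores this first term.\<close>

lemma locally_uniform_limit_shift:
  assumes "locally_uniform_limit S F l" "\<And>r z. z \<in> S \<Longrightarrow> f (Suc r) z = F r z"
  shows "locally_uniform_limit S f l"
  unfolding locally_uniform_limit_def
proof
  fix z assume "z \<in> S"
  then obtain U where U: "open U" "z \<in> U" and lim: "uniform_limit (U \<inter> S) F l sequentially"
    using assms(1) by (auto simp: locally_uniform_limit_def)
  from lim have "uniform_limit (U \<inter> S) (\<lambda>r. f (Suc r)) l sequentially"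
    by (rule uniform_limit_cong'[THEN iffD1, rotated -1]) (use assms(2) in auto)
  then have "uniform_limit (U \<inter> S) f l sequentially"
    unfolding uniform_limit_iff by (simp add: eventually_sequentially_Suc[of "\<lambda>r. \<forall>x\<in>_. dist (f r x) (l x) < _"])
  with U show "\<exists>U. open U \<and> z \<in> U \<and> uniform_limit (U \<inter> S) f l sequentially"
    by blast
qed

lemma A_star_pos: "ks \<noteq> [] \<Longrightarrow> A_star ks n > 0"
proof (induction ks arbitrary: n rule: list_nonempty_induct)
  case (cons j ks)
  then show ?case
    by (cases ks) (auto simp: A_star_Cons_Cons intro!: divide_pos_pos sum_pos)
qed (simp add: A_star_singleton)

section \<open>Conclusions at finite and infinite depth\<close>

lemma Li_star_finite_depth:
  assumes ks: "ks \<noteq> []" "\<forall>k\<in>set ks. k \<ge> 1"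
  shows "(\<forall>z. norm z < 1 \<longrightarrow> (\<lambda>n. complex_of_real (A_star ks n) * z ^ n) sums Li_star_shifted ks z)"
    and "completely_monotone (A_star ks)"
    and "A_star ks 0 = 1"
    and "has_hausdorff_stieltjes slit_plane (Li_star_shifted_ext ks)"
    and "holomorphic_extension (ball 0 1) (Li_star ks) (Li_star_ext ks)"
    and "univalent_on (Li_star_ext ks) half_plane_D"
    and "holomorphic_extension (ball 0 1) (Li_star_shifted ks) (Li_star_shifted_ext ks)"
    and "univalent_on (Li_star_shifted_ext ks) half_plane_D"
proof -
  obtain M where M: "unit_interval_prob M" and A: "A_star ks = moment M"
    using hausdorff_moments_A_star[OF ks] by (auto simp: hausdorff_moments_def)
  interpret unit_interval_prob M by fact
  show "\<forall>z. norm z < 1 \<longrightarrow> (\<lambda>n. complex_of_real (A_star ks n) * z ^ n) sums Li_star_shifted ks z"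
    using stieltjes_sums Li_star_shifted_eq_stieltjes[OF ks(1) A] by (simp add: A)
  show "completely_monotone (A_star ks)"
    unfolding A by (rule completely_monotone_moment)
  show "A_star ks 0 = 1"
    unfolding A by (rule moment_0)
  show "has_hausdorff_stieltjes slit_plane (Li_star_shifted_ext ks)"
    by (intro has_hausdorff_stieltjes_stieltjes Li_star_ext_eq ks A)
  show "holomorphic_extension (ball 0 1) (Li_star ks) (Li_star_ext ks)"
    "holomorphic_extension (ball 0 1) (Li_star_shifted ks) (Li_star_shifted_ext ks)"
    by (intro holomorphic_extension_Li_star_ext ks A)+
  show "univalent_on (Li_star_ext ks) half_plane_D"
    by (rule univalent_on_cong[OF univalent_mult_stieltjes])
       (use Li_star_ext_eq[OF ks(1) A] half_plane_D_subset_slit_plane in auto)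
  have "moment M 1 > 0"
    using A_star_pos[OF ks(1)] by (simp add: A)
  then show "univalent_on (Li_star_shifted_ext ks) half_plane_D"
    by (rule univalent_on_cong[OF univalent_stieltjes])
       (use Li_star_ext_eq[OF ks(1) A] half_plane_D_subset_slit_plane in auto)
qed

lemma Li_star_infinite_depth:
  fixes k :: "nat \<Rightarrow> nat"
  assumes k: "\<And>i. k i \<ge> 1"
  obtains L Ls where
    "locally_uniform_limit half_plane_D (\<lambda>r. Li_star_ext (map k [0..<r])) L"
    "locally_uniform_limit half_plane_D (\<lambda>r. Li_star_shifted_ext (map k [0..<r])) Ls"
    "univalent_on L half_plane_D" "univalent_on Ls half_plane_D"
    "has_hausdorff_stieltjes half_plane_D Ls"
proof -
  \<comment> \<open>Shifted by one, so that every \<open>ks r\<close> is nonempty.\<close>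
  define ks where "ks r = map k [0..<Suc r]" for r
  have ks: "ks r \<noteq> []" "\<forall>k\<in>set (ks r). k \<ge> 1" for r
    using k by (auto simp: ks_def)
  have "\<forall>r. \<exists>N. unit_interval_prob N \<and> A_star (ks r) = moment N"
    using hausdorff_moments_A_star[OF ks] by (simp add: hausdorff_moments_def)
  then obtain N where "\<forall>r. unit_interval_prob (N r) \<and> A_star (ks r) = moment (N r)"
    by (rule choice[THEN exE])
  then have N: "\<And>r. unit_interval_prob (N r)" and A: "\<And>r. A_star (ks r) = moment (N r)"
    by auto
  have mono: "incseq (\<lambda>r. A_star (ks r) n)" for n
    by (rule incseq_SucI) (use A_star_le_append[OF ks(1)] in \<open>simp add: ks_def\<close>)
  have "convergent (\<lambda>r. A_star (ks r) n)" for n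
    using unit_interval_prob.moment_le_1[OF N]
    by (intro Bseq_mono_convergent BseqI'[of _ 1] allI impI incseqD[OF mono])
       (simp_all add: A_star_nonneg, simp add: A)
  then obtain b where b: "\<And>n. (\<lambda>r. A_star (ks r) n) \<longlonglongrightarrow> b n"
    unfolding convergent_def by metis
  have "hausdorff_moments b"
    by (rule hausdorff_moments_limit[OF hausdorff_moments_A_star[OF ks] b])
  then obtain M where M: "unit_interval_prob M" and bM: "b = moment M"
    by (auto simp: hausdorff_moments_def)
  interpret unit_interval_prob M by fact
  have lim: "(\<lambda>r. moment (N r) n) \<longlonglongrightarrow> moment M n" for n
    using b[of n] by (simp add: A bM)
  have ext: "Li_star_ext (map k [0..<Suc r]) z = z * stieltjes (N r) z"
    "Li_star_shifted_ext (map k [0..<Suc r]) z = stieltjes (N r) z" if "z \<in> half_plane_D" for r z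
    using unit_interval_prob.Li_star_ext_eq[OF N ks(1) A] that half_plane_D_subset_slit_plane
    unfolding ks_def by blast+
  \<comment> \<open>The first moment at the limit is at least its value at depth one, so the limit
    measure cannot collapse to the point mass at 0 and the shifted limit stays univalent.\<close>
  have "0 < A_star (ks 0) 1"
    using ks by (intro A_star_pos)
  also have "\<dots> \<le> moment M 1"
    using incseq_le[OF mono b] by (simp add: bM)
  finally have "moment M 1 > 0" .
  show ?thesis
  proof (rule that)
    show "locally_uniform_limit half_plane_D (\<lambda>r. Li_star_ext (map k [0..<r])) (\<lambda>z. z * stieltjes M z)"
      by (rule locally_uniform_limit_shift[OF locally_uniform_limit_stieltjes(2)[OF N M lim]]) (rule ext)
    show "locally_uniform_limit half_plane_D (\<lambda>r. Li_star_shifted_ext (map k [0..<r])) (stieltjes M)"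
      by (rule locally_uniform_limit_shift[OF locally_uniform_limit_stieltjes(1)[OF N M lim]]) (rule ext)
    show "univalent_on (\<lambda>z. z * stieltjes M z) half_plane_D"
      by (rule univalent_mult_stieltjes)
    show "univalent_on (stieltjes M) half_plane_D"
      by (rule univalent_stieltjes) fact
    show "has_hausdorff_stieltjes half_plane_D (stieltjes M)"
      by (rule has_hausdorff_stieltjes_stieltjes) (rule refl)
  qed
qed

theorem theorem1p1:
  shows
    "(\<forall>ks :: nat list. ks \<noteq> [] \<and> (\<forall>k\<in>set ks. k \<ge> 1) \<longrightarrow>
        \<comment> \<open>(i)\<close>
        ((\<forall>z. norm z < 1 \<longrightarrow>
            (\<lambda>n. complex_of_real (A_star ks n) * z ^ n) sums Li_star_shifted ks z) \<and>
         completely_monotone (A_star ks) \<and>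
         A_star ks 0 = 1 \<and>
         has_hausdorff_stieltjes slit_plane (Li_star_shifted_ext ks)) \<and>
        \<comment> \<open>(ii)\<close>
        (holomorphic_extension (ball 0 1) (Li_star ks) (Li_star_ext ks) \<and>
         univalent_on (Li_star_ext ks) half_plane_D) \<and>
        \<comment> \<open>(iii)\<close>
        (holomorphic_extension (ball 0 1) (Li_star_shifted ks) (Li_star_shifted_ext ks) \<and>
         univalent_on (Li_star_shifted_ext ks) half_plane_D)) \<and>
     \<comment> \<open>(iv)\<close>
     (\<forall>k :: nat \<Rightarrow> nat. (\<forall>i. k i \<ge> 1) \<longrightarrow>
        (\<exists>L Ls.
           locally_uniform_limit half_plane_D (\<lambda>r. Li_star_ext (map k [0..<r])) L \<and>
           locally_uniform_limit half_plane_D (\<lambda>r. Li_star_shifted_ext (map k [0..<r])) Ls \<and>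
           univalent_on L half_plane_D \<and>
           univalent_on Ls half_plane_D \<and>
           has_hausdorff_stieltjes half_plane_D Ls))"
proof (rule conjI; intro allI impI)
  fix ks :: "nat list" assume "ks \<noteq> [] \<and> (\<forall>k\<in>set ks. k \<ge> 1)"
  then have ks: "ks \<noteq> []" "\<forall>k\<in>set ks. k \<ge> 1"
    by auto
  show "((\<forall>z. norm z < 1 \<longrightarrow>
            (\<lambda>n. complex_of_real (A_star ks n) * z ^ n) sums Li_star_shifted ks z) \<and>
         completely_monotone (A_star ks) \<and>
         A_star ks 0 = 1 \<and>
         has_hausdorff_stieltjes slit_plane (Li_star_shifted_ext ks)) \<and>
        (holomorphic_extension (ball 0 1) (Li_star ks) (Li_star_ext ks) \<and>
         univalent_on (Li_star_ext ks) half_plane_D) \<and>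
        (holomorphic_extension (ball 0 1) (Li_star_shifted ks) (Li_star_shifted_ext ks) \<and>
         univalent_on (Li_star_shifted_ext ks) half_plane_D)"
    by (intro conjI Li_star_finite_depth[OF ks])
next
  fix k :: "nat \<Rightarrow> nat" assume "\<forall>i. k i \<ge> 1"
  then show "\<exists>L Ls.
           locally_uniform_limit half_plane_D (\<lambda>r. Li_star_ext (map k [0..<r])) L \<and>
           locally_uniform_limit half_plane_D (\<lambda>r. Li_star_shifted_ext (map k [0..<r])) Ls \<and>
           univalent_on L half_plane_D \<and>
           univalent_on Ls half_plane_D \<and>
           has_hausdorff_stieltjes half_plane_D Ls"
    using Li_star_infinite_depth[of k] by metis
qed

end
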